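(* Let $n\ge1$. The integer $r=\lfloor n/2\rfloor+1$ is the smallest integer such that every generic $n\times n$ complex matrix is a product of $r$ Toeplitz matrices.
   Context: A Toeplitz matrix is an $n\times n$ complex matrix $(a_{i,j})$ whose entries are constant along diagonals ($a_{i,j}$ depends only on $j-i$). "Every generic $n\times n$ matrix has property $P$" means that the Zariski closure of the set of matrices in $\mathbb{C}^{n\times n}\simeq\mathbb{C}^{n^2}$ not having property $P$ is a proper closed subset of $\mathbb{C}^{n\times n}$. All Toeplitz factors are $n\times n$ with complex entries. *)

theory Defs
  imports "Jordan_Normal_Form.Matrix"
begin

definition toeplitz :: "nat \<Rightarrow> complex mat \<Rightarrow> bool" where
  "toeplitz n A \<longleftrightarrow> A \<in> carrier_mat n n \<and>
     (\<exists>a :: int \<Rightarrow> complex. \<forall>i < n. \<forall>j < n. A $$ (i, j) = a (int j - int i))"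

definition product_of_toeplitz :: "nat \<Rightarrow> nat \<Rightarrow> complex mat \<Rightarrow> bool" where
  "product_of_toeplitz n r A \<longleftrightarrow>
     (\<exists>Ts. length Ts = r \<and> (\<forall>T \<in> set Ts. toeplitz n T) \<and> A = foldr (*) Ts (1\<^sub>m n))"

(* Polynomials in the n^2 entries of an n x n matrix, taken as functions. Since the complex
   field is infinite, a polynomial is determined by its function on n x n matrices. *)
inductive_set poly_funs :: "nat \<Rightarrow> (complex mat \<Rightarrow> complex) set" for n :: nat where
  const: "(\<lambda>A. c) \<in> poly_funs n"
| entry: "i < n \<Longrightarrow> j < n \<Longrightarrow> (\<lambda>A. A $$ (i, j)) \<in> poly_funs n"
| add: "p \<in> poly_funs n \<Longrightarrow> q \<in> poly_funs n \<Longrightarrow> (\<lambda>A. p A + q A) \<in> poly_funs n"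
| mult: "p \<in> poly_funs n \<Longrightarrow> q \<in> poly_funs n \<Longrightarrow> (\<lambda>A. p A * q A) \<in> poly_funs n"

definition zariski_closed :: "nat \<Rightarrow> complex mat set \<Rightarrow> bool" where
  "zariski_closed n S \<longleftrightarrow>
     (\<exists>F \<subseteq> poly_funs n. S = {A \<in> carrier_mat n n. \<forall>p \<in> F. p A = 0})"

definition zariski_closure :: "nat \<Rightarrow> complex mat set \<Rightarrow> complex mat set" where
  "zariski_closure n S = \<Inter> {T. zariski_closed n T \<and> S \<subseteq> T}"

definition every_generic :: "nat \<Rightarrow> (complex mat \<Rightarrow> bool) \<Rightarrow> bool" where
  "every_generic n P \<longleftrightarrow>
     zariski_closure n {A \<in> carrier_mat n n. \<not> P A} \<subset> carrier_mat n n"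

end

theory Submission
  imports Defs "HOL-Library.Function_Algebras"
    "HOL-Computational_Algebra.Fundamental_Theorem_Algebra"
begin

text \<open>
  Why \<open>n div 2\<close> factors do not suffice: they have fewer than \<open>n * n\<close> parameters, so their products satisfy a
  nontrivial polynomial equation (\<open>few_toeplitz_hypersurface\<close>). If almost every matrix were such a product, this
  equation multiplied by one of the exceptional hypersurface would vanish everywhere, but polynomial functions
  have no zero divisors.

  Why \<open>r = n div 2 + 1\<close> factors suffice: the products are the image of a polynomial map, and two facts about
  this map are combined.

  First, its image is dense: no nonzero polynomial vanishes on it (\<open>toeplitz_products_dense\<close>). Put \<open>S\<^sub>k\<close> for the
  symmetric Toeplitz matrix with ones on the diagonals \<open>k\<close> and \<open>- k\<close>. Near the product of the matrices
  \<open>1 + \<epsilon>\<^sub>k S\<^sub>k\<close> with \<open>1 \<le> k \<le> n div 2\<close>, where the \<open>\<epsilon>\<^sub>k\<close> are very small and of very different size, the products of \<open>r\<close>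
  Toeplitz matrices move, to leading order, in all directions \<open>Y\<^sub>0 + \<Sum>\<^sub>k S\<^sub>k Y\<^sub>k\<close> with Toeplitz \<open>Y\<^sub>k\<close>
  (\<open>degenerating_products\<close>). The term \<open>S\<^sub>k Y\<close> arises when the factor \<open>1 + \<epsilon>\<^sub>k S\<^sub>k\<close> is perturbed by \<open>- Y\<close> and the
  product to its right by \<open>Y\<close>: the two cancel up to \<open>\<epsilon>\<^sub>k S\<^sub>k Y\<close> and smaller terms. These directions fill
  the whole space (\<open>direction_all\<close>): a diagonal times \<open>S\<^sub>k\<close> is, modulo full diagonals, a diagonal cut off at a
  place that depends on \<open>k\<close>, all possible cuts occur, and the difference of neighbouring cuts is a matrix
  unit. For odd \<open>n\<close> the count is exact: each cut occurs once.

  Second, a polynomial map over \<open>\<complex>\<close> with dense image hits every point off a proper hypersurface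
  (\<open>dense_param_image_generic\<close>). A point of the target is a homomorphism from its coordinate ring to \<open>\<complex>\<close>; if a
  certain nonzero element is not sent to zero, the homomorphism extends to the coordinate ring of the
  parameters, one generator at a time (\<open>extend_hom_adjoin\<close>), and the extension is a preimage.
\<close>

section \<open>Polynomial functions and generic properties\<close>

lemma poly_funs_sum:
  assumes "\<And>i. i \<in> I \<Longrightarrow> f i \<in> poly_funs n"
  shows "(\<lambda>Z. \<Sum>i\<in>I. f i Z) \<in> poly_funs n"
  using assms by (induction I rule: infinite_finite_induct) (auto intro: poly_funs.intros)

lemma poly_funs_prod:
  assumes "\<And>i. i \<in> I \<Longrightarrow> f i \<in> poly_funs n"
  shows "(\<lambda>Z. \<Prod>i\<in>I. f i Z) \<in> poly_funs n"
  using assms by (induction I rule: infinite_finite_induct) (auto intro: poly_funs.intros)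

lemma poly_funs_power: "f \<in> poly_funs n \<Longrightarrow> (\<lambda>Z. f Z ^ k) \<in> poly_funs n"
  by (induction k) (auto intro: poly_funs.intros)

lemma poly_funs_tendsto:
  assumes "p \<in> poly_funs n"
    and "\<And>i j. i < n \<Longrightarrow> j < n \<Longrightarrow> ((\<lambda>x. M x $$ (i, j)) \<longlongrightarrow> Z $$ (i, j)) F"
  shows "((\<lambda>x. p (M x)) \<longlongrightarrow> p Z) F"
  using assms(1) by induction (auto intro!: tendsto_intros assms(2))

definition poly_entries :: "nat \<Rightarrow> (complex \<Rightarrow> complex mat) \<Rightarrow> bool" where
  "poly_entries n A \<longleftrightarrow> (\<forall>e. A e \<in> carrier_mat n n) \<and>
     (\<forall>i<n. \<forall>j<n. \<exists>p. \<forall>e. A e $$ (i, j) = poly p e)"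

lemma poly_entries_const: "M \<in> carrier_mat n n \<Longrightarrow> poly_entries n (\<lambda>e. M)"
  unfolding poly_entries_def by (auto intro!: exI[of _ "[:_:]"])

lemma poly_entries_add:
  assumes "poly_entries n A" "poly_entries n B"
  shows "poly_entries n (\<lambda>e. A e + B e)"
  unfolding poly_entries_def
proof (intro conjI allI impI)
  fix i j assume ij: "i < n" "j < n"
  obtain p q where "\<forall>e. A e $$ (i, j) = poly p e" "\<forall>e. B e $$ (i, j) = poly q e"
    using assms ij unfolding poly_entries_def by metis
  moreover have "(A e + B e) $$ (i, j) = A e $$ (i, j) + B e $$ (i, j)" for e
    using assms(2) ij carrier_matD[of "B e" n n] by (auto simp: poly_entries_def)
  ultimately show "\<exists>p. \<forall>e. (A e + B e) $$ (i, j) = poly p e"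
    by (intro exI[of _ "p + q"]) simp
qed (use assms in \<open>auto simp: poly_entries_def\<close>)

lemma poly_entries_smult:
  assumes "poly_entries n A"
  shows "poly_entries n (\<lambda>e. poly c e \<cdot>\<^sub>m A e)"
  unfolding poly_entries_def
proof (intro conjI allI impI)
  fix i j assume ij: "i < n" "j < n"
  obtain p where "\<forall>e. A e $$ (i, j) = poly p e"
    using assms ij unfolding poly_entries_def by metis
  moreover have "(poly c e \<cdot>\<^sub>m A e) $$ (i, j) = poly c e * A e $$ (i, j)" for e
    using assms ij carrier_matD[of "A e" n n] by (auto simp: poly_entries_def)
  ultimately show "\<exists>p. \<forall>e. (poly c e \<cdot>\<^sub>m A e) $$ (i, j) = poly p e"
    by (intro exI[of _ "c * p"]) simp
qed (use assms in \<open>auto simp: poly_entries_def\<close>)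

lemma poly_entries_const_mult:
  assumes "poly_entries n A" "M \<in> carrier_mat n n"
  shows "poly_entries n (\<lambda>e. M * A e)"
  unfolding poly_entries_def
proof (intro conjI allI impI)
  fix i j assume ij: "i < n" "j < n"
  have "\<forall>k. \<exists>p. k < n \<longrightarrow> (\<forall>e. A e $$ (k, j) = poly p e)"
    using assms(1) ij by (auto simp: poly_entries_def)
  from choice[OF this] obtain p where p: "\<And>k e. k < n \<Longrightarrow> A e $$ (k, j) = poly (p k) e"
    by blast
  have "(M * A e) $$ (i, j) = poly (\<Sum>k<n. smult (M $$ (i, k)) (p k)) e" for e
  proof -
    have "A e \<in> carrier_mat n n" using assms(1) by (simp add: poly_entries_def)
    then have "(M * A e) $$ (i, j) = (\<Sum>k<n. M $$ (i, k) * A e $$ (k, j))"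
      using assms(2) ij by (simp add: scalar_prod_def atLeast0LessThan)
    then show ?thesis by (simp add: p poly_sum)
  qed
  then show "\<exists>p. \<forall>e. (M * A e) $$ (i, j) = poly p e" by blast
qed (use assms in \<open>auto simp: poly_entries_def\<close>)

lemma poly_entries_subst:
  assumes "poly_entries n A"
  shows "poly_entries n (\<lambda>e. A (poly c e))"
  unfolding poly_entries_def
proof (intro conjI allI impI)
  fix i j assume ij: "i < n" "j < n"
  obtain p where "\<forall>e. A e $$ (i, j) = poly p e"
    using assms ij unfolding poly_entries_def by metis
  then show "\<exists>p. \<forall>e. A (poly c e) $$ (i, j) = poly p e"
    by (intro exI[of _ "pcompose p c"]) (simp add: poly_pcompose)
qed (use assms in \<open>auto simp: poly_entries_def\<close>)

lemma poly_funs_along_curve: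
  assumes "p \<in> poly_funs n" "poly_entries n M"
  shows "\<exists>q. \<forall>e. p (M e) = poly q e"
  using assms(1)
proof induction
  case (const c)
  show ?case by (rule exI[of _ "[:c:]"]) simp
next
  case (entry i j)
  then show ?case using assms(2) unfolding poly_entries_def by blast
next
  case (add p q)
  then obtain u v where "\<forall>e. p (M e) = poly u e" "\<forall>e. q (M e) = poly v e" by blast
  then show ?case by (intro exI[of _ "u + v"]) simp
next
  case (mult p q)
  then obtain u v where "\<forall>e. p (M e) = poly u e" "\<forall>e. q (M e) = poly v e" by blast
  then show ?case by (intro exI[of _ "u * v"]) simp
qed

lemma poly_prod_nonzero_somewhere:
  fixes p q :: "complex poly"
  assumes "poly p a \<noteq> 0" "poly q b \<noteq> 0"
  shows "\<exists>e. poly p e * poly q e \<noteq> 0"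
proof (rule ccontr)
  assume "\<not> ?thesis"
  then have "poly (p * q) = poly 0" by (auto simp: fun_eq_iff)
  then have "p * q = 0" by (simp only: poly_eq_poly_eq_iff)
  then show False using assms by auto
qed

text \<open>
  On the line that joins a non-zero of one factor to a non-zero of the other, both are nonzero polynomials
  in one variable.
\<close>

lemma poly_funs_domain:
  assumes "p \<in> poly_funs n" "q \<in> poly_funs n" "A \<in> carrier_mat n n" "B \<in> carrier_mat n n"
    and "p A \<noteq> 0" "q B \<noteq> 0"
  shows "\<exists>M\<in>carrier_mat n n. p M * q M \<noteq> 0"
proof -
  \<comment> \<open>The line through \<open>A\<close> and \<open>B\<close>.\<close>
  define M where "M = (\<lambda>e. A + poly [:0, 1:] e \<cdot>\<^sub>m (B + (-1) \<cdot>\<^sub>m A))"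
  have M: "poly_entries n M"
    unfolding M_def using assms(3,4) by (intro poly_entries_add poly_entries_smult poly_entries_const) auto
  obtain u v where u: "\<And>e. p (M e) = poly u e" and v: "\<And>e. q (M e) = poly v e"
    using poly_funs_along_curve[OF assms(1) M] poly_funs_along_curve[OF assms(2) M] by auto
  have "M 0 = A" "M 1 = B" using assms(3,4) by (auto simp: M_def intro!: eq_matI)
  then have "poly u 0 \<noteq> 0" "poly v 1 \<noteq> 0" using assms(5,6) u[of 0] v[of 1] by auto
  then obtain e where "poly u e * poly v e \<noteq> 0" using poly_prod_nonzero_somewhere by blast
  then show ?thesis using u v M by (intro bexI[of _ "M e"]) (auto simp: poly_entries_def)
qed

text \<open>
  The form in which genericity is used: the property holds off some proper hypersurface.
  One polynomial suffices because a point outside the closure is separated from it by a single equation.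
\<close>

lemma every_generic_iff:
  "every_generic n P \<longleftrightarrow>
    (\<exists>q\<in>poly_funs n. (\<exists>M\<in>carrier_mat n n. q M \<noteq> 0) \<and> (\<forall>A\<in>carrier_mat n n. q A \<noteq> 0 \<longrightarrow> P A))"
proof
  let ?bad = "{A \<in> carrier_mat n n. \<not> P A}"
  assume "every_generic n P"
  then obtain M T where M: "M \<in> carrier_mat n n" "zariski_closed n T" "?bad \<subseteq> T" "M \<notin> T"
    unfolding every_generic_def zariski_closure_def by blast
  then obtain F where F: "F \<subseteq> poly_funs n" "T = {A \<in> carrier_mat n n. \<forall>p\<in>F. p A = 0}"
    unfolding zariski_closed_def by blast
  then obtain q where q: "q \<in> F" "q M \<noteq> 0" using M by auto
  then have "\<forall>A\<in>carrier_mat n n. q A \<noteq> 0 \<longrightarrow> P A" using M F by auto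
  then show "\<exists>q\<in>poly_funs n. (\<exists>M\<in>carrier_mat n n. q M \<noteq> 0) \<and> (\<forall>A\<in>carrier_mat n n. q A \<noteq> 0 \<longrightarrow> P A)"
    using q F M by blast
next
  let ?bad = "{A \<in> carrier_mat n n. \<not> P A}"
  assume "\<exists>q\<in>poly_funs n. (\<exists>M\<in>carrier_mat n n. q M \<noteq> 0) \<and> (\<forall>A\<in>carrier_mat n n. q A \<noteq> 0 \<longrightarrow> P A)"
  then obtain q M where q: "q \<in> poly_funs n" "M \<in> carrier_mat n n" "q M \<noteq> 0"
    and P: "\<forall>A\<in>carrier_mat n n. q A \<noteq> 0 \<longrightarrow> P A" by (elim bexE conjE)
  define T where "T = {A \<in> carrier_mat n n. q A = 0}"
  have "T = {A \<in> carrier_mat n n. \<forall>p\<in>{q}. p A = 0}" by (simp add: T_def)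
  with q(1) have closed: "zariski_closed n T"
    unfolding zariski_closed_def by (intro exI[of _ "{q}"] conjI) simp_all
  have sub: "?bad \<subseteq> T"
  proof (rule subsetI)
    fix A assume "A \<in> ?bad"
    then show "A \<in> T" using P[rule_format, of A] by (cases "q A = 0") (simp_all add: T_def)
  qed
  have "zariski_closure n ?bad \<subseteq> T"
    unfolding zariski_closure_def using closed sub by (intro Inter_lower) simp
  moreover have "T \<subset> carrier_mat n n"
    unfolding T_def using q(2,3) by (intro psubsetI) auto
  ultimately show "every_generic n P" unfolding every_generic_def by (rule subset_psubset_trans)
qed

section \<open>Extending homomorphisms to the complex numbers\<close>

definition is_subring :: "'a::comm_ring_1 set \<Rightarrow> bool" where
  "is_subring A \<longleftrightarrow> 1 \<in> A \<and> (\<forall>x\<in>A. \<forall>y\<in>A. x - y \<in> A \<and> x * y \<in> A)"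

text \<open>
  Homomorphisms to \<open>\<complex>\<close> that matter only on a subring; such a map is a point of the variety whose
  coordinate ring the subring is. The zero is preserved because of additivity.
\<close>

definition hom_on :: "'a::comm_ring_1 set \<Rightarrow> ('a \<Rightarrow> complex) \<Rightarrow> bool" where
  "hom_on A \<phi> \<longleftrightarrow> \<phi> 1 = 1 \<and>
     (\<forall>x\<in>A. \<forall>y\<in>A. \<phi> (x + y) = \<phi> x + \<phi> y \<and> \<phi> (x * y) = \<phi> x * \<phi> y)"

definition polys_over :: "'a::comm_ring_1 set \<Rightarrow> 'a poly set" where
  "polys_over A = {p. \<forall>i. coeff p i \<in> A}"

definition adjoin :: "'a::comm_ring_1 set \<Rightarrow> 'a \<Rightarrow> 'a set" where
  "adjoin A b = (\<lambda>p. poly p b) ` polys_over A"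

lemma subring_closed:
  assumes "is_subring A"
  shows "0 \<in> A" "1 \<in> A" "x \<in> A \<Longrightarrow> y \<in> A \<Longrightarrow> x - y \<in> A" "x \<in> A \<Longrightarrow> y \<in> A \<Longrightarrow> x * y \<in> A"
    "x \<in> A \<Longrightarrow> - x \<in> A" "x \<in> A \<Longrightarrow> y \<in> A \<Longrightarrow> x + y \<in> A"
proof -
  have D: "x - y \<in> A" if "x \<in> A" "y \<in> A" for x y
    using assms that by (auto simp: is_subring_def)
  show one: "1 \<in> A" and "x \<in> A \<Longrightarrow> y \<in> A \<Longrightarrow> x * y \<in> A" and "x \<in> A \<Longrightarrow> y \<in> A \<Longrightarrow> x - y \<in> A"
    using assms by (auto simp: is_subring_def)
  show zero: "0 \<in> A" using D[OF one one] by simp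
  have U: "- x \<in> A" if "x \<in> A" for x using D[OF zero that] by simp
  then show "x \<in> A \<Longrightarrow> - x \<in> A" .
  show "x \<in> A \<Longrightarrow> y \<in> A \<Longrightarrow> x + y \<in> A" using D[of x "- y"] U[of y] by simp
qed

lemma subring_sum:
  assumes "is_subring A" "\<And>i. i \<in> I \<Longrightarrow> f i \<in> A"
  shows "sum f I \<in> A"
  using assms(2) by (induction I rule: infinite_finite_induct) (auto intro: subring_closed[OF assms(1)])

lemma subring_power:
  assumes "is_subring A" "x \<in> A"
  shows "x ^ k \<in> A"
  by (induction k) (auto intro: subring_closed[OF assms(1)] assms(2))

lemma subring_polys_over:
  assumes "is_subring A"
  shows "is_subring (polys_over A)"
  using assms unfolding is_subring_def[of "polys_over A"]
  by (auto simp: polys_over_def coeff_mult coeff_1 intro!: subring_closed subring_sum)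

lemma polys_over_pCons:
  assumes "is_subring A" "a \<in> A" "p \<in> polys_over A"
  shows "pCons a p \<in> polys_over A"
  using assms by (auto simp: polys_over_def coeff_pCons split: nat.split)

lemma polys_over_monom:
  assumes "is_subring A" "a \<in> A"
  shows "monom a k \<in> polys_over A"
  using assms subring_closed(1)[OF assms(1)] by (auto simp: polys_over_def)

lemma polys_over_smult:
  assumes "is_subring A" "a \<in> A" "p \<in> polys_over A"
  shows "smult a p \<in> polys_over A"
  using assms by (auto simp: polys_over_def intro: subring_closed)

lemma polys_over_const:
  assumes "is_subring A" "a \<in> A"
  shows "[:a:] \<in> polys_over A"
  using polys_over_monom[OF assms, of 0] by (simp add: monom_0)

lemma subring_adjoin:
  assumes "is_subring A"
  shows "is_subring (adjoin A b)"
proof -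
  note P = subring_closed[OF subring_polys_over[OF assms]]
  show ?thesis
    unfolding is_subring_def adjoin_def
    by (auto intro: P image_eqI[where x = 1] image_eqI[where x = "p - q" for p q] image_eqI[where x = "p * q" for p q])
qed

lemma adjoin_superset:
  assumes "is_subring A" "a \<in> A"
  shows "a \<in> adjoin A b"
  unfolding adjoin_def by (rule image_eqI[of _ _ "[:a:]"]) (auto intro: polys_over_const assms)

lemma adjoin_generator:
  assumes "is_subring A"
  shows "b \<in> adjoin A b"
  unfolding adjoin_def
  by (rule image_eqI[of _ _ "[:0, 1:]"])
     (auto intro!: polys_over_pCons polys_over_const assms subring_closed[OF assms])

lemma subring_poly_in:
  assumes "is_subring B" "A \<subseteq> B" "b \<in> B" "p \<in> polys_over A"
  shows "poly p b \<in> B"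
  unfolding poly_altdef using assms
  by (intro subring_sum subring_closed(4) subring_power) (auto simp: polys_over_def)

lemma adjoin_subset:
  assumes "is_subring B" "A \<subseteq> B" "b \<in> B"
  shows "adjoin A b \<subseteq> B"
  using subring_poly_in[OF assms] by (auto simp: adjoin_def)

lemma hom_on_simps:
  assumes "is_subring A" "hom_on A \<phi>"
  shows "\<phi> 0 = 0" "\<phi> 1 = 1" "x \<in> A \<Longrightarrow> y \<in> A \<Longrightarrow> \<phi> (x + y) = \<phi> x + \<phi> y"
    "x \<in> A \<Longrightarrow> y \<in> A \<Longrightarrow> \<phi> (x * y) = \<phi> x * \<phi> y"
proof -
  have "\<phi> (0 + 0) = \<phi> 0 + \<phi> 0"
    using assms subring_closed(1)[OF assms(1)] unfolding hom_on_def by blast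
  then show "\<phi> 0 = 0" by simp
qed (use assms in \<open>auto simp: hom_on_def\<close>)

lemma hom_on_sum:
  assumes "is_subring A" "hom_on A \<phi>" "\<And>i. i \<in> I \<Longrightarrow> f i \<in> A"
  shows "\<phi> (sum f I) = (\<Sum>i\<in>I. \<phi> (f i))"
  using assms(3) by (induction I rule: infinite_finite_induct)
    (auto simp: hom_on_simps[OF assms(1,2)] subring_sum[OF assms(1)])

lemma map_poly_hom:
  assumes A: "is_subring A" and \<phi>: "hom_on A \<phi>" and p: "p \<in> polys_over A" "q \<in> polys_over A"
  shows "map_poly \<phi> (p + q) = map_poly \<phi> p + map_poly \<phi> q"
    "map_poly \<phi> (p * q) = map_poly \<phi> p * map_poly \<phi> q"
proof -
  note h = hom_on_simps[OF A \<phi>]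
  have c: "coeff p i \<in> A" "coeff q i \<in> A" for i using p by (auto simp: polys_over_def)
  show "map_poly \<phi> (p + q) = map_poly \<phi> p + map_poly \<phi> q"
    by (rule poly_eqI) (simp add: coeff_map_poly h c)
  show "map_poly \<phi> (p * q) = map_poly \<phi> p * map_poly \<phi> q"
    by (rule poly_eqI)
      (simp add: coeff_map_poly coeff_mult h c hom_on_sum[OF A \<phi>] subring_closed(4)[OF A])
qed

text \<open>
  Division with remainder over a ring without inverses, at the price of a power of the leading
  coefficient of the divisor. The coefficients stay in the given subring.
\<close>

lemma pseudo_division:
  assumes A: "is_subring A" and r: "r \<in> polys_over A" and p: "p \<in> polys_over A"
  shows "\<exists>k q s. q \<in> polys_over A \<and> s \<in> polys_over A \<and>
    smult (lead_coeff r ^ k) p = q * r + s \<and> (s = 0 \<or> degree s < degree r)"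
  using p
proof (induction "degree p" arbitrary: p rule: less_induct)
  case less
  note P = subring_closed[OF subring_polys_over[OF A]]
  let ?l = "lead_coeff r"
  have l: "?l \<in> A" using r by (auto simp: polys_over_def)
  show ?case
  proof (cases "degree p < degree r")
    case True
    then show ?thesis using less.prems P(1)
      by (intro exI[of _ 0] exI[of _ 0] exI[of _ p]) auto
  next
    case False
    \<comment> \<open>Cross-multiplying with the two leading coefficients cancels the top term without dividing.\<close>
    define m where "m = monom (lead_coeff p) (degree p - degree r)"
    define p' where "p' = smult ?l p - m * r"
    have m: "m \<in> polys_over A"
      unfolding m_def using less.prems by (intro polys_over_monom A) (auto simp: polys_over_def)
    have p': "p' \<in> polys_over A"
      unfolding p'_def using m r less.prems l by (intro P polys_over_smult A)
    have "degree (m * r) \<le> degree p"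
      using degree_mult_le[of m r] degree_monom_le[of "lead_coeff p" "degree p - degree r"] False
      unfolding m_def by linarith
    then have 1: "degree p' \<le> degree p"
      unfolding p'_def by (intro degree_diff_le) (auto intro: degree_smult_le)
    have 2: "coeff p' (degree p) = 0"
      using False unfolding p'_def m_def by (simp add: coeff_monom_mult mult.commute[of "lead_coeff r"])
    have "p' = 0 \<or> degree p' < degree p" by (rule eq_zero_or_degree_less[OF 1 2])
    then show ?thesis
    proof
      assume "p' = 0"
      then show ?thesis using m P(1)
        by (intro exI[of _ 1] exI[of _ m] exI[of _ 0]) (auto simp: p'_def)
    next
      assume "degree p' < degree p"
      from less.hyps[OF this p'] obtain k q s where
        IH: "q \<in> polys_over A" "s \<in> polys_over A" "smult (?l ^ k) p' = q * r + s"
          "s = 0 \<or> degree s < degree r" by blast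
      have "smult (?l ^ Suc k) p = smult (?l ^ k) (p' + m * r)"
        by (simp add: p'_def mult.commute)
      also have "\<dots> = (q + smult (?l ^ k) m) * r + s"
        by (simp add: smult_add_right IH(3) algebra_simps)
      finally show ?thesis using IH m
        by (intro exI[of _ "Suc k"] exI[of _ "q + smult (?l ^ k) m"] exI[of _ s])
           (auto intro!: P polys_over_smult subring_power A l)
    qed
  qed
qed

text \<open>
  The hypothesis says that \<open>x\<close> satisfies the images of all relations of \<open>b\<close>, so that \<open>b \<mapsto> x\<close> gives a value at
  \<open>poly p b\<close> that is independent of the choice of \<open>p\<close>.
\<close>

lemma extend_hom_by_value:
  assumes A: "is_subring A" and \<phi>: "hom_on A \<phi>"
    and wd: "\<And>p. p \<in> polys_over A \<Longrightarrow> poly p b = 0 \<Longrightarrow> poly (map_poly \<phi> p) x = 0"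
  shows "\<exists>\<psi>. hom_on (adjoin A b) \<psi> \<and> (\<forall>a\<in>A. \<psi> a = \<phi> a) \<and>
    (\<forall>p\<in>polys_over A. \<psi> (poly p b) = poly (map_poly \<phi> p) x)"
proof -
  note P = subring_closed[OF subring_polys_over[OF A]]
  define \<psi> where "\<psi> = (\<lambda>y. poly (map_poly \<phi> (SOME p. p \<in> polys_over A \<and> poly p b = y)) x)"
  have val: "\<psi> (poly p b) = poly (map_poly \<phi> p) x" if p: "p \<in> polys_over A" for p
  proof -
    define q where "q = (SOME q. q \<in> polys_over A \<and> poly q b = poly p b)"
    have q: "q \<in> polys_over A" "poly q b = poly p b"
      using someI[of "\<lambda>q. q \<in> polys_over A \<and> poly q b = poly p b" p] p by (auto simp: q_def)
    have "poly (map_poly \<phi> (q - p)) x = 0" using q p by (intro wd P) auto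
    moreover have "map_poly \<phi> q = map_poly \<phi> (q - p) + map_poly \<phi> p"
      using map_poly_hom(1)[OF A \<phi> P(3)[OF q(1) p] p] by simp
    ultimately show ?thesis by (simp add: \<psi>_def q_def)
  qed
  have restr: "\<psi> a = \<phi> a" if "a \<in> A" for a
    using val[OF polys_over_const[OF A that]]
    by (simp add: map_poly_pCons hom_on_simps(1)[OF A \<phi>] split: if_splits)
  have "hom_on (adjoin A b) \<psi>"
    unfolding hom_on_def adjoin_def
    using restr[OF subring_closed(2)[OF A]] hom_on_simps(2)[OF A \<phi>]
    by (auto simp: val map_poly_hom[OF A \<phi>] P poly_add[symmetric] poly_mult[symmetric]
        simp del: poly_add poly_mult)
  then show ?thesis using restr val by blast
qed

text \<open>
  The extension theorem that replaces elimination theory: after inverting one nonzero element of \<open>A\<close>,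
  every point of \<open>A\<close> lifts to a point of \<open>A[b]\<close>, and the lift can avoid the zeros of a given nonzero \<open>h\<close>.
  Keeping \<open>h\<close> nonzero is what allows generators to be adjoined one after another. Algebraic closedness
  enters through the root of the image of the relation of least degree. The domain is the subring \<open>B\<close>, because
  the ring of all functions, to which this is applied, has zero divisors.
\<close>

lemma extend_hom_adjoin:
  fixes B :: "'a::comm_ring_1 set"
  assumes B: "is_subring B" and dom: "\<And>x y. x \<in> B \<Longrightarrow> y \<in> B \<Longrightarrow> x * y = 0 \<Longrightarrow> x = 0 \<or> y = 0"
    and A: "is_subring A" "A \<subseteq> B" and b: "b \<in> B"
    and h: "h \<in> adjoin A b" "h \<noteq> 0"
  shows "\<exists>a\<in>A. a \<noteq> 0 \<and> (\<forall>\<phi>. hom_on A \<phi> \<and> \<phi> a \<noteq> 0 \<longrightarrow>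
     (\<exists>\<psi>. hom_on (adjoin A b) \<psi> \<and> (\<forall>x\<in>A. \<psi> x = \<phi> x) \<and> \<psi> h \<noteq> 0))"
proof -
  note P = subring_closed[OF subring_polys_over[OF A(1)]]
  note sm = polys_over_smult[OF A(1)]
  have lcA: "lead_coeff p \<in> A" if "p \<in> polys_over A" for p using that by (auto simp: polys_over_def)
  have inB: "poly p b \<in> B" if "p \<in> polys_over A" for p
    using subring_poly_in[OF B A(2) b that] .
  obtain H where H: "H \<in> polys_over A" "h = poly H b" using h(1) by (auto simp: adjoin_def)
  show ?thesis
  proof (cases "\<forall>p\<in>polys_over A. poly p b = 0 \<longrightarrow> p = 0")
    case True
    \<comment> \<open>\<open>b\<close> is transcendental over \<open>A\<close>: any value will do for it, except the finitely many roots
      of the image of \<open>H\<close>.\<close>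
    show ?thesis
    proof (intro bexI[of _ "lead_coeff H"] conjI allI impI)
      show "lead_coeff H \<noteq> 0" using h H by auto
      show "lead_coeff H \<in> A" by (rule lcA[OF H(1)])
      fix \<phi> assume \<phi>: "hom_on A \<phi> \<and> \<phi> (lead_coeff H) \<noteq> 0"
      note hs = hom_on_simps[OF A(1) conjunct1[OF \<phi>]]
      have "map_poly \<phi> H \<noteq> 0"
        using \<phi> by (metis coeff_0 coeff_map_poly hs(1))
      then have "finite {x. poly (map_poly \<phi> H) x = 0}" by (rule poly_roots_finite)
      then obtain x where x: "poly (map_poly \<phi> H) x \<noteq> 0"
        using infinite_UNIV_char_0[where 'a = complex] by (metis (mono_tags, lifting) UNIV_eq_I mem_Collect_eq)
      have "poly (map_poly \<phi> p) x = 0" if "p \<in> polys_over A" "poly p b = 0" for p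
        using True that by auto
      from extend_hom_by_value[OF A(1) conjunct1[OF \<phi>] this] obtain \<psi> where
        "hom_on (adjoin A b) \<psi>" "\<forall>a\<in>A. \<psi> a = \<phi> a"
        "\<forall>p\<in>polys_over A. \<psi> (poly p b) = poly (map_poly \<phi> p) x" by blast
      then show "\<exists>\<psi>. hom_on (adjoin A b) \<psi> \<and> (\<forall>x\<in>A. \<psi> x = \<phi> x) \<and> \<psi> h \<noteq> 0"
        using H x by (intro exI[of _ \<psi>]) auto
    qed
  next
    case False
    \<comment> \<open>\<open>b\<close> is algebraic. A relation \<open>\<mu>\<close> of least degree stands in for the minimal polynomial over
      the fraction field; inverting its leading coefficient \<open>l\<close> makes \<open>b\<close> integral.\<close>
    define rel where "rel = (\<lambda>p. p \<in> polys_over A \<and> p \<noteq> 0 \<and> poly p b = 0)"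
    obtain \<mu> where \<mu>: "rel \<mu>" and \<mu>min: "\<And>p. rel p \<Longrightarrow> degree \<mu> \<le> degree p"
      using False ex_has_least_nat[of rel _ degree] unfolding rel_def by blast
    have \<mu>': "\<mu> \<in> polys_over A" "\<mu> \<noteq> 0" "poly \<mu> b = 0" using \<mu> by (auto simp: rel_def)
    define l where "l = lead_coeff \<mu>"
    have l: "l \<in> A" "l \<noteq> 0" using \<mu>' lcA by (auto simp: l_def)
    have small: "p = 0" if "p \<in> polys_over A" "poly p b = 0" "p = 0 \<or> degree p < degree \<mu>" for p
      using \<mu>min[of p] that unfolding rel_def by fastforce
    have lpow: "l ^ k \<noteq> 0" for k
    proof (induction k)
      case 0
      show ?case using h(2) by (auto simp: H)
    next
      case (Suc k)
      then show ?case using dom[of l "l ^ k"] l A subring_power[OF A(1) l(1), of k] by auto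
    qed
    \<comment> \<open>Multiples of \<open>h\<close> in \<open>A[b]\<close>. A nonzero one represented in least degree is a constant: otherwise
      by its minimality it would divide a
      multiple of \<open>\<mu>\<close> and leave a relation of smaller degree. So \<open>h\<close> divides a nonzero element \<open>a'\<close> of \<open>A\<close>.\<close>
    define mult where "mult = (\<lambda>r. r \<in> polys_over A \<and> poly r b \<noteq> 0 \<and>
      (\<exists>g\<in>polys_over A. poly r b = h * poly g b))"
    have red: "\<exists>r. mult r \<and> degree r < degree \<mu>"
    proof -
      obtain k q s where s: "q \<in> polys_over A" "s \<in> polys_over A"
        "smult (l ^ k) H = q * \<mu> + s" "s = 0 \<or> degree s < degree \<mu>"
        using pseudo_division[OF A(1) \<mu>'(1) H(1)] unfolding l_def by blast
      have e: "l ^ k * h = poly s b"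
        using arg_cong[OF s(3), of "\<lambda>p. poly p b"] \<mu>'(3) H(2) by simp
      have lk: "l ^ k \<in> A" by (rule subring_power[OF A(1) l(1)])
      have "poly s b \<noteq> 0"
        using dom[of "l ^ k" h] lk A(2) inB[OF H(1)] H(2) h(2) lpow[of k] e by auto
      moreover have sb: "poly s b = h * poly [:l ^ k:] b" using e by (simp add: mult.commute)
      ultimately show ?thesis
        using s(2) sb polys_over_const[OF A(1) lk] unfolding mult_def
        by (intro exI[of _ s] conjI bexI[of _ "[:l ^ k:]"]) (use s(4) in auto)
    qed
    obtain r where r: "mult r" and rmin: "\<And>p. mult p \<Longrightarrow> degree r \<le> degree p"
      using red ex_has_least_nat[of mult _ degree] by blast
    have rdeg: "degree r < degree \<mu>" using red rmin by (meson le_less_trans)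
    obtain g where r': "r \<in> polys_over A" "poly r b \<noteq> 0" and g: "g \<in> polys_over A" "poly r b = h * poly g b"
      using r by (auto simp: mult_def)
    have "degree r = 0"
    proof (rule ccontr)
      assume pos: "degree r \<noteq> 0"
      define c where "c = lead_coeff r"
      have c: "c \<in> A" "c \<noteq> 0" using r' lcA by (auto simp: c_def)
      obtain k q s where s: "q \<in> polys_over A" "s \<in> polys_over A"
        "smult (c ^ k) \<mu> = q * r + s" "s = 0 \<or> degree s < degree r"
        using pseudo_division[OF A(1) r'(1) \<mu>'(1)] unfolding c_def by blast
      have e: "poly s b = - (poly q b * poly r b)"
        using arg_cong[OF s(3), of "\<lambda>p. poly p b"] \<mu>'(3) by (simp add: eq_neg_iff_add_eq_0 add.commute)
      have "poly s b = 0"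
      proof (rule ccontr)
        assume nz: "poly s b \<noteq> 0"
        have "poly s b = h * poly (- q * g) b" using e g(2) by (simp add: algebra_simps)
        moreover have "- q * g \<in> polys_over A" using s(1) g(1) by (intro P)
        ultimately have "mult s" using nz s(2) unfolding mult_def by blast
        then have "degree r \<le> degree s" by (rule rmin)
        then show False using s(4) nz by auto
      qed
      then have s0: "s = 0" using small[OF s(2)] s(4) rdeg by auto
      then have "poly q b = 0"
        using dom[OF inB[OF s(1)] inB[OF r'(1)]] e r'(2) by auto
      moreover have clk: "c ^ k * l \<noteq> 0"
      proof -
        have "c ^ j * l \<noteq> 0" for j
        proof (induction j)
          case (Suc j)
          then show ?case
            using dom[of c "c ^ j * l"] c l A subring_power[OF A(1) c(1), of j]
              subring_closed(4)[OF A(1)] by (auto simp: mult.assoc)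
        qed (use l in simp)
        then show ?thesis .
      qed
      have qr: "coeff (q * r) (degree \<mu>) \<noteq> 0"
        using arg_cong[OF s(3), of "\<lambda>p. coeff p (degree \<mu>)"] s0 clk by (simp add: l_def)
      have "q \<noteq> 0" using qr by auto
      moreover have "degree q < degree \<mu>"
      proof (rule ccontr)
        assume "\<not> degree q < degree \<mu>"
        have "lead_coeff q * c \<noteq> 0"
          using dom[of "lead_coeff q" c] c A lcA[OF s(1)] \<open>q \<noteq> 0\<close> by auto
        then have "degree q + degree r \<le> degree (q * r)"
          by (intro le_degree) (simp add: coeff_mult_degree_sum c_def)
        also have "\<dots> \<le> degree \<mu>"
          using s(3) s0 degree_smult_le[of "c ^ k" \<mu>] by simp
        finally show False using pos \<open>\<not> degree q < degree \<mu>\<close> by linarith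
      qed
      ultimately show False using small[OF s(1)] by auto
    qed
    then obtain a' where a': "r = [:a':]" by (meson degree_eq_zeroE)
    have a'A: "a' \<in> A" "a' \<noteq> 0" using lcA[OF r'(1)] r'(2) a' by auto
    show ?thesis
    proof (intro bexI[of _ "l * a'"] conjI allI impI)
      show "l * a' \<noteq> 0" using dom[of l a'] a'A l A by auto
      show "l * a' \<in> A" using a'A l by (intro subring_closed(4)[OF A(1)])
      fix \<phi> assume "hom_on A \<phi> \<and> \<phi> (l * a') \<noteq> 0"
      then have \<phi>: "hom_on A \<phi>" "\<phi> (l * a') \<noteq> 0" by auto
      note hs = hom_on_simps[OF A(1) \<phi>(1)]
      have nz: "\<phi> l \<noteq> 0" "\<phi> a' \<noteq> 0" using \<phi>(2) hs(4)[OF l(1) a'A(1)] by auto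
      have \<phi>pow: "\<phi> (l ^ k) \<noteq> 0" for k
        by (induction k) (auto simp: hs nz l subring_power[OF A(1)])
      have "degree (map_poly \<phi> \<mu>) = degree \<mu>"
        using nz(1) unfolding l_def by (rule map_poly_degree_eq)
      then have "\<not> constant (poly (map_poly \<phi> \<mu>))"
        using rdeg by (simp add: constant_degree)
      then obtain x where x: "poly (map_poly \<phi> \<mu>) x = 0"
        using fundamental_theorem_of_algebra by blast
      have "poly (map_poly \<phi> p) x = 0" if p: "p \<in> polys_over A" "poly p b = 0" for p
      proof -
        obtain k q s where s: "q \<in> polys_over A" "s \<in> polys_over A"
          "smult (l ^ k) p = q * \<mu> + s" "s = 0 \<or> degree s < degree \<mu>"
          using pseudo_division[OF A(1) \<mu>'(1) p(1)] unfolding l_def by blast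
        have lk: "l ^ k \<in> A" by (rule subring_power[OF A(1) l(1)])
        have "poly s b = 0"
          using arg_cong[OF s(3), of "\<lambda>p. poly p b"] \<mu>'(3) p(2) by simp
        then have "s = 0" using small[OF s(2)] s(4) by auto
        then have "[:l ^ k:] * p = q * \<mu>" using s(3) by simp
        then have "map_poly \<phi> [:l ^ k:] * map_poly \<phi> p = map_poly \<phi> q * map_poly \<phi> \<mu>"
          using map_poly_hom(2)[OF A(1) \<phi>(1)] polys_over_const[OF A(1) lk] p(1) s(1) \<mu>'(1) by metis
        from arg_cong[OF this, of "\<lambda>p. poly p x"]
        show ?thesis using x \<phi>pow[of k] by (simp add: map_poly_pCons hs(1))
      qed
      from extend_hom_by_value[OF A(1) \<phi>(1) this] obtain \<psi> where
        \<psi>: "hom_on (adjoin A b) \<psi>" "\<forall>a\<in>A. \<psi> a = \<phi> a" by blast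
      note hs' = hom_on_simps[OF subring_adjoin[OF A(1)] \<psi>(1)]
      have "poly g b \<in> adjoin A b" using g(1) by (auto simp: adjoin_def)
      then have "\<phi> a' = \<psi> h * \<psi> (poly g b)"
        using hs'(4)[OF h(1)] g(2) a' a'A(1) \<psi>(2) by auto
      then have "\<psi> h \<noteq> 0" using nz by auto
      then show "\<exists>\<psi>. hom_on (adjoin A b) \<psi> \<and> (\<forall>x\<in>A. \<psi> x = \<phi> x) \<and> \<psi> h \<noteq> 0"
        using \<psi> by blast
    qed
  qed
qed

text \<open>
  The element to be kept nonzero at each step is the one that has to be inverted for the remaining
  generators.
\<close>

lemma extend_hom_adjoin_list:
  fixes B :: "'a::comm_ring_1 set"
  assumes B: "is_subring B" and dom: "\<And>x y. x \<in> B \<Longrightarrow> y \<in> B \<Longrightarrow> x * y = 0 \<Longrightarrow> x = 0 \<or> y = 0"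
    and one: "(1::'a) \<noteq> 0" and A: "is_subring A" "A \<subseteq> B" and bs: "set bs \<subseteq> B"
  shows "\<exists>a\<in>A. a \<noteq> 0 \<and> (\<forall>\<phi>. hom_on A \<phi> \<and> \<phi> a \<noteq> 0 \<longrightarrow>
     (\<exists>A' \<psi>. is_subring A' \<and> A \<subseteq> A' \<and> set bs \<subseteq> A' \<and> hom_on A' \<psi> \<and> (\<forall>x\<in>A. \<psi> x = \<phi> x)))"
  using A bs
proof (induction bs arbitrary: A)
  case Nil
  show ?case
    using one subring_closed(2)[OF Nil(1)] Nil(1) by (intro bexI[of _ 1]) auto
next
  case (Cons b bs)
  have b: "b \<in> B" "set bs \<subseteq> B" using Cons.prems(3) by auto
  let ?A = "adjoin A b"
  have A': "is_subring ?A" "?A \<subseteq> B" "A \<subseteq> ?A" "b \<in> ?A"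
    using subring_adjoin[OF Cons.prems(1)] adjoin_subset[OF B Cons.prems(2) b(1)]
      adjoin_superset[OF Cons.prems(1)] adjoin_generator[OF Cons.prems(1)] by auto
  from Cons.IH[OF A'(1,2) b(2)] obtain h where h: "h \<in> ?A" "h \<noteq> 0" and
    ext: "\<And>\<phi>. hom_on ?A \<phi> \<and> \<phi> h \<noteq> 0 \<Longrightarrow>
     (\<exists>A' \<psi>. is_subring A' \<and> ?A \<subseteq> A' \<and> set bs \<subseteq> A' \<and> hom_on A' \<psi> \<and> (\<forall>x\<in>?A. \<psi> x = \<phi> x))"
    by blast
  from extend_hom_adjoin[OF B dom Cons.prems(1,2) b(1) h] obtain a where
    a: "a \<in> A" "a \<noteq> 0" and step: "\<And>\<phi>. hom_on A \<phi> \<and> \<phi> a \<noteq> 0 \<Longrightarrow>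
     (\<exists>\<psi>. hom_on ?A \<psi> \<and> (\<forall>x\<in>A. \<psi> x = \<phi> x) \<and> \<psi> h \<noteq> 0)" by blast
  show ?case
  proof (intro bexI[of _ a] conjI allI impI a)
    fix \<phi> assume "hom_on A \<phi> \<and> \<phi> a \<noteq> 0"
    from step[OF this] obtain \<psi> where \<psi>: "hom_on ?A \<psi>" "\<forall>x\<in>A. \<psi> x = \<phi> x" "\<psi> h \<noteq> 0" by blast
    from ext[OF conjI[OF \<psi>(1,3)]] obtain A'' \<psi>' where
      "is_subring A''" "?A \<subseteq> A''" "set bs \<subseteq> A''" "hom_on A'' \<psi>'" "\<forall>x\<in>?A. \<psi>' x = \<psi> x" by blast
    then show "\<exists>A' \<psi>. is_subring A' \<and> A \<subseteq> A' \<and> set (b # bs) \<subseteq> A' \<and> hom_on A' \<psi> \<and> (\<forall>x\<in>A. \<psi> x = \<phi> x)"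
      using A' \<psi>(2) by (intro exI[of _ A''] exI[of _ \<psi>']) auto
  qed
qed

section \<open>Images of dense polynomial maps\<close>

text \<open>
  Polynomial functions of parameters indexed by \<open>V\<close>, forming the coordinate ring of the parameter space.
\<close>

inductive_set coord_funs :: "'v set \<Rightarrow> (('v \<Rightarrow> complex) \<Rightarrow> complex) set" for V :: "'v set" where
  const: "(\<lambda>t. c) \<in> coord_funs V"
| coord: "v \<in> V \<Longrightarrow> (\<lambda>t. t v) \<in> coord_funs V"
| add: "f \<in> coord_funs V \<Longrightarrow> g \<in> coord_funs V \<Longrightarrow> (\<lambda>t. f t + g t) \<in> coord_funs V"
| mult: "f \<in> coord_funs V \<Longrightarrow> g \<in> coord_funs V \<Longrightarrow> (\<lambda>t. f t * g t) \<in> coord_funs V"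

lemma coord_funs_sum:
  assumes "\<And>i. i \<in> I \<Longrightarrow> f i \<in> coord_funs V"
  shows "(\<lambda>t. \<Sum>i\<in>I. f i t) \<in> coord_funs V"
  using assms by (induction I rule: infinite_finite_induct) (auto intro: coord_funs.intros)

lemma subring_coord_funs: "is_subring (coord_funs V)"
proof -
  have "(\<lambda>t. f t + (- 1) * g t) \<in> coord_funs V" if "f \<in> coord_funs V" "g \<in> coord_funs V" for f g
    using that by (intro coord_funs.intros)
  then show ?thesis
    unfolding is_subring_def one_fun_def fun_diff_def times_fun_def
    by (auto intro: coord_funs.const coord_funs.mult)
qed

lemma coord_funs_line:
  assumes "f \<in> coord_funs V"
  shows "\<exists>p. \<forall>e. f (\<lambda>v. a v + e * b v) = poly p e"
  using assms
proof induction
  case (const c)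
  show ?case by (rule exI[of _ "[:c:]"]) simp
next
  case (coord v)
  show ?case by (rule exI[of _ "[:a v, b v:]"]) simp
next
  case (add f g)
  then obtain p q where "\<forall>e. f (\<lambda>v. a v + e * b v) = poly p e" "\<forall>e. g (\<lambda>v. a v + e * b v) = poly q e"
    by blast
  then show ?case by (intro exI[of _ "p + q"]) simp
next
  case (mult f g)
  then obtain p q where "\<forall>e. f (\<lambda>v. a v + e * b v) = poly p e" "\<forall>e. g (\<lambda>v. a v + e * b v) = poly q e"
    by blast
  then show ?case by (intro exI[of _ "p * q"]) simp
qed

text \<open>
  As for matrices, a line through a non-zero of each factor reduces this to one variable.
\<close>

lemma coord_funs_domain:
  assumes "f \<in> coord_funs V" "g \<in> coord_funs V" "f * g = 0"
  shows "f = 0 \<or> g = 0"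
proof (rule ccontr)
  assume "\<not> ?thesis"
  then obtain a b where ab: "f a \<noteq> 0" "g b \<noteq> 0" by (auto simp: fun_eq_iff)
  define l where "l = (\<lambda>e v. a v + e * (b v - a v))"
  obtain p q where p: "\<And>e. f (l e) = poly p e" and q: "\<And>e. g (l e) = poly q e"
    using coord_funs_line[OF assms(1), of a "\<lambda>v. b v - a v"]
      coord_funs_line[OF assms(2), of a "\<lambda>v. b v - a v"] unfolding l_def by auto
  have "l 0 = a" "l 1 = b" by (auto simp: l_def)
  then have "poly p 0 \<noteq> 0" "poly q 1 \<noteq> 0" using ab p[of 0] q[of 1] by auto
  then obtain e where "poly p e * poly q e \<noteq> 0" using poly_prod_nonzero_somewhere by blast
  then show False using p q fun_cong[OF assms(3), of "l e"] by simp
qed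

text \<open>
  A polynomial map with dense image hits every point off some hypersurface. The coordinate ring of the
  target embeds, by density, into that of the parameters; a point of the target is a homomorphism on the
  smaller ring, and an extension of it to the larger one is a preimage.
\<close>

lemma dense_param_image_generic:
  fixes F :: "('v \<Rightarrow> complex) \<Rightarrow> complex mat"
  assumes V: "finite V"
    and entries: "\<And>i j. i < n \<Longrightarrow> j < n \<Longrightarrow> (\<lambda>t. F t $$ (i, j)) \<in> coord_funs V"
    and F: "\<And>t. F t \<in> carrier_mat n n"
    and dense: "\<And>p A. p \<in> poly_funs n \<Longrightarrow> (\<And>t. p (F t) = 0) \<Longrightarrow> A \<in> carrier_mat n n \<Longrightarrow> p A = 0"
  shows "every_generic n (\<lambda>A. A \<in> range F)"
proof -
  define R where "R = (\<lambda>q t. q (F t)) ` poly_funs n"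
  have diff: "(\<lambda>A. p A - q A) \<in> poly_funs n" if "p \<in> poly_funs n" "q \<in> poly_funs n" for p q
  proof -
    have "(\<lambda>A. p A + (- 1) * q A) \<in> poly_funs n" using that by (intro poly_funs.intros)
    then show ?thesis by simp
  qed
  have inR: "(\<lambda>t. q (F t)) \<in> R" if "q \<in> poly_funs n" for q using that by (auto simp: R_def)
  have R: "is_subring R"
    unfolding is_subring_def
  proof (intro conjI ballI)
    show "1 \<in> R" using inR[OF poly_funs.const[of 1]] by (simp add: one_fun_def)
    fix x y assume "x \<in> R" "y \<in> R"
    then obtain p q where pq: "p \<in> poly_funs n" "q \<in> poly_funs n" "x = (\<lambda>t. p (F t))" "y = (\<lambda>t. q (F t))"
      by (auto simp: R_def)
    show "x - y \<in> R" using inR[OF diff[OF pq(1,2)]] by (simp add: pq fun_diff_def)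
    show "x * y \<in> R" using inR[OF poly_funs.mult[OF pq(1,2)]] by (simp add: pq times_fun_def)
  qed
  have RB: "R \<subseteq> coord_funs V"
  proof
    fix x assume "x \<in> R"
    then obtain q where q: "q \<in> poly_funs n" and x: "x = (\<lambda>t. q (F t))" by (auto simp: R_def)
    show "x \<in> coord_funs V" unfolding x
      using q by induction (auto intro: coord_funs.intros entries)
  qed
  \<comment> \<open>The coordinates generate the ring of all polynomial functions of the parameters over \<open>R\<close>.\<close>
  obtain vs where vs: "set vs = V" using finite_list[OF V] by blast
  define bs where "bs = map (\<lambda>v t. t v :: complex) vs"
  have bs: "set bs \<subseteq> coord_funs V" by (auto simp: bs_def vs intro: coord_funs.coord)
  have "(1 :: ('v \<Rightarrow> complex) \<Rightarrow> complex) \<noteq> 0" by (simp add: fun_eq_iff)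
  moreover have "x = 0 \<or> y = 0" if "x \<in> coord_funs V" "y \<in> coord_funs V" "x * y = 0" for x y
    by (rule coord_funs_domain[OF that])
  ultimately have "\<exists>a\<in>R. a \<noteq> 0 \<and> (\<forall>\<phi>. hom_on R \<phi> \<and> \<phi> a \<noteq> 0 \<longrightarrow>
     (\<exists>A' \<psi>. is_subring A' \<and> R \<subseteq> A' \<and> set bs \<subseteq> A' \<and> hom_on A' \<psi> \<and> (\<forall>x\<in>R. \<psi> x = \<phi> x)))"
    by (intro extend_hom_adjoin_list[OF subring_coord_funs _ _ R RB bs])
  then
  obtain a where a: "a \<in> R" "a \<noteq> 0" and ext: "\<And>\<phi>. hom_on R \<phi> \<and> \<phi> a \<noteq> 0 \<Longrightarrow>
      \<exists>A' \<psi>. is_subring A' \<and> R \<subseteq> A' \<and> set bs \<subseteq> A' \<and> hom_on A' \<psi> \<and> (\<forall>x\<in>R. \<psi> x = \<phi> x)"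
    by blast
  obtain q where q: "q \<in> poly_funs n" "a = (\<lambda>t. q (F t))" using a(1) by (auto simp: R_def)
  obtain t0 where "q (F t0) \<noteq> 0" using a(2) q(2) by (auto simp: fun_eq_iff)
  then have "\<exists>M\<in>carrier_mat n n. q M \<noteq> 0" using F by blast
  moreover have "A \<in> range F" if A: "A \<in> carrier_mat n n" "q A \<noteq> 0" for A
  proof -
    \<comment> \<open>Evaluation at \<open>A\<close> is a homomorphism on \<open>R\<close>; density is what makes it well defined.\<close>
    define \<phi> where "\<phi> = (\<lambda>x. (SOME p. p \<in> poly_funs n \<and> x = (\<lambda>t. p (F t))) A)"
    have \<phi>: "\<phi> (\<lambda>t. p (F t)) = p A" if p: "p \<in> poly_funs n" for p
    proof -
      define p' where "p' = (SOME p'. p' \<in> poly_funs n \<and> (\<lambda>t. p (F t)) = (\<lambda>t. p' (F t)))"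
      have p': "p' \<in> poly_funs n \<and> (\<lambda>t. p (F t)) = (\<lambda>t. p' (F t))"
        unfolding p'_def by (rule someI[of _ p]) (use p in auto)
      have "p' A - p A = 0"
        using dense[OF diff[of p' p] _ A(1)] p p' by (auto simp: fun_eq_iff)
      then show ?thesis by (simp add: \<phi>_def p'_def)
    qed
    have "hom_on R \<phi>"
      unfolding hom_on_def
    proof (intro conjI ballI)
      show "\<phi> 1 = 1" using \<phi>[OF poly_funs.const[of 1]] by (simp add: one_fun_def)
      fix x y assume "x \<in> R" "y \<in> R"
      then obtain p q where pq: "p \<in> poly_funs n" "q \<in> poly_funs n" "x = (\<lambda>t. p (F t))" "y = (\<lambda>t. q (F t))"
        by (auto simp: R_def)
      show "\<phi> (x + y) = \<phi> x + \<phi> y" using \<phi>[OF poly_funs.add[OF pq(1,2)]] \<phi> pq by (simp add: plus_fun_def)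
      show "\<phi> (x * y) = \<phi> x * \<phi> y" using \<phi>[OF poly_funs.mult[OF pq(1,2)]] \<phi> pq by (simp add: times_fun_def)
    qed
    moreover have "\<phi> a \<noteq> 0" using \<phi>[OF q(1)] q(2) A(2) by simp
    ultimately obtain A' \<psi> where A': "is_subring A'" "R \<subseteq> A'" "set bs \<subseteq> A'"
      and \<psi>: "hom_on A' \<psi>" "\<forall>x\<in>R. \<psi> x = \<phi> x" using ext by blast
    note hs = hom_on_simps[OF A'(1) \<psi>(1)]
    \<comment> \<open>The images of the coordinates under the extension are the wanted parameters.\<close>
    define t where "t = (\<lambda>v. \<psi> (\<lambda>t. t v))"
    have eval: "f \<in> A' \<and> \<psi> f = f t" if "f \<in> coord_funs V" for f
      using that
    proof induction
      case (const c)
      show ?case using \<phi>[OF poly_funs.const[of c]] inR[OF poly_funs.const[of c]] A'(2) \<psi>(2) by auto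
    next
      case (coord v)
      then show ?case using A'(3) vs by (auto simp: bs_def t_def)
    next
      case (add f g)
      then show ?case using hs(3)[of f g] subring_closed(6)[OF A'(1), of f g] by (simp add: plus_fun_def)
    next
      case (mult f g)
      then show ?case using hs(4)[of f g] subring_closed(4)[OF A'(1), of f g] by (simp add: times_fun_def)
    qed
    have "F t $$ (i, j) = A $$ (i, j)" if ij: "i < n" "j < n" for i j
      using eval[OF entries[OF ij]] \<phi>[OF poly_funs.entry[OF ij]] inR[OF poly_funs.entry[OF ij]] \<psi>(2)
      by simp
    then have "F t = A" using F[of t] A(1) by (intro eq_matI) auto
    then show ?thesis by blast
  qed
  ultimately show ?thesis unfolding every_generic_iff by (intro bexI[OF _ q(1)] conjI ballI impI)
qed

section \<open>Toeplitz matrices and their products\<close>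

definition toep :: "nat \<Rightarrow> (int \<Rightarrow> complex) \<Rightarrow> complex mat" where
  "toep n a = mat n n (\<lambda>(i, j). a (int j - int i))"

lemma toep_carrier [simp]: "toep n a \<in> carrier_mat n n"
  by (simp add: toep_def)

lemma toeplitz_iff_toep: "toeplitz n A \<longleftrightarrow> (\<exists>a. A = toep n a)"
proof
  assume "toeplitz n A"
  then obtain a where "A \<in> carrier_mat n n" "\<forall>i<n. \<forall>j<n. A $$ (i, j) = a (int j - int i)"
    by (auto simp: toeplitz_def)
  then have "A = toep n a" by (intro eq_matI) (auto simp: toep_def)
  then show "\<exists>a. A = toep n a" by blast
qed (auto simp: toeplitz_def toep_def)

lemma toeplitz_toep [simp]: "toeplitz n (toep n a)"
  by (auto simp: toeplitz_iff_toep)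

lemma toeplitz_carrier: "toeplitz n A \<Longrightarrow> A \<in> carrier_mat n n"
  by (simp add: toeplitz_def)

lemma toeplitz_add:
  assumes "toeplitz n A" "toeplitz n B"
  shows "toeplitz n (A + B)"
proof -
  obtain a b where "A = toep n a" "B = toep n b" using assms by (auto simp: toeplitz_iff_toep)
  then have "A + B = toep n (\<lambda>d. a d + b d)" by (intro eq_matI) (auto simp: toep_def)
  then show ?thesis by simp
qed

lemma toeplitz_smult:
  assumes "toeplitz n A"
  shows "toeplitz n (c \<cdot>\<^sub>m A)"
proof -
  obtain a where "A = toep n a" using assms by (auto simp: toeplitz_iff_toep)
  then have "c \<cdot>\<^sub>m A = toep n (\<lambda>d. c * a d)" by (intro eq_matI) (auto simp: toep_def)
  then show ?thesis by simp
qed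

lemma toeplitz_one: "toeplitz n (1\<^sub>m n)"
proof -
  have "1\<^sub>m n = toep n (\<lambda>d. if d = 0 then 1 else 0)" by (intro eq_matI) (auto simp: toep_def)
  then show ?thesis by simp
qed

lemma toeplitz_zero: "toeplitz n (0\<^sub>m n n)"
proof -
  have "0\<^sub>m n n = toep n (\<lambda>d. 0)" by (intro eq_matI) (auto simp: toep_def)
  then show ?thesis by simp
qed

lemma product_of_toeplitz_Suc:
  assumes "toeplitz n T" "product_of_toeplitz n r A"
  shows "product_of_toeplitz n (Suc r) (T * A)"
proof -
  obtain Ts where "length Ts = r" "\<forall>T\<in>set Ts. toeplitz n T" "A = foldr (*) Ts (1\<^sub>m n)"
    using assms(2) by (auto simp: product_of_toeplitz_def)
  then show ?thesis using assms(1) unfolding product_of_toeplitz_def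
    by (intro exI[of _ "T # Ts"]) auto
qed

lemma product_of_toeplitz_1:
  assumes "toeplitz n T"
  shows "product_of_toeplitz n (Suc 0) T"
  using assms toeplitz_carrier[OF assms] unfolding product_of_toeplitz_def
  by (intro exI[of _ "[T]"]) auto

definition param_product :: "nat \<Rightarrow> nat list \<Rightarrow> (nat \<times> int \<Rightarrow> complex) \<Rightarrow> complex mat" where
  "param_product n is t = foldr (\<lambda>i. (*) (toep n (\<lambda>d. t (i, d)))) is (1\<^sub>m n)"

lemma param_product_simps:
  "param_product n [] t = 1\<^sub>m n"
  "param_product n (i # is) t = toep n (\<lambda>d. t (i, d)) * param_product n is t"
  by (simp_all add: param_product_def)

lemma param_product_carrier [simp]: "param_product n is t \<in> carrier_mat n n"
  by (induction "is") (auto simp: param_product_simps intro: mult_carrier_mat[OF toep_carrier])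

lemma product_of_toeplitz_iff_param:
  "product_of_toeplitz n r A \<longleftrightarrow> (\<exists>t. A = param_product n [0..<r] t)"
proof
  assume "product_of_toeplitz n r A"
  then obtain Ts where Ts: "length Ts = r" "\<forall>T\<in>set Ts. toeplitz n T" "A = foldr (*) Ts (1\<^sub>m n)"
    by (auto simp: product_of_toeplitz_def)
  have "\<forall>i. \<exists>a. i < r \<longrightarrow> Ts ! i = toep n a"
    using Ts(1,2) by (auto simp: toeplitz_iff_toep)
  from choice[OF this] obtain a where a: "\<And>i. i < r \<Longrightarrow> Ts ! i = toep n (a i)" by blast
  have "Ts = map (\<lambda>i. toep n (\<lambda>d. case_prod a (i, d))) [0..<r]"
    using Ts(1) a by (intro nth_equalityI) auto
  then have "A = param_product n [0..<r] (case_prod a)"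
    unfolding Ts(3) param_product_def by (simp add: foldr_map comp_def)
  then show "\<exists>t. A = param_product n [0..<r] t" by blast
next
  assume "\<exists>t. A = param_product n [0..<r] t"
  then obtain t where t: "A = param_product n [0..<r] t" by blast
  show "product_of_toeplitz n r A"
    unfolding product_of_toeplitz_def t param_product_def
    by (intro exI[of _ "map (\<lambda>i. toep n (\<lambda>d. t (i, d))) [0..<r]"]) (auto simp: foldr_map comp_def)
qed

text \<open>
  The parameters on which a product really depends.
\<close>

definition params :: "nat \<Rightarrow> nat list \<Rightarrow> (nat \<times> int) set" where
  "params n is = set is \<times> {1 - int n..int n - 1}"

lemma param_product_entry:
  assumes "a < n" "b < n"
  shows "param_product n (i # is) t $$ (a, b) =
    (\<Sum>l<n. t (i, int l - int a) * param_product n is t $$ (l, b))"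
  using assms carrier_matD[OF param_product_carrier, of n "is" t]
  by (simp add: param_product_simps toep_def scalar_prod_def atLeast0LessThan)

lemma param_product_coord_funs:
  assumes "a < n" "b < n" "set is \<subseteq> set js"
  shows "(\<lambda>t. param_product n is t $$ (a, b)) \<in> coord_funs (params n js)"
  using assms(1,3)
proof (induction "is" arbitrary: a)
  case Nil
  then show ?case using assms(2) by (auto simp: param_product_simps intro: coord_funs.const)
next
  case (Cons i "is")
  show ?case unfolding param_product_entry[OF Cons.prems(1) assms(2)] using Cons
    by (intro coord_funs_sum coord_funs.mult coord_funs.coord) (auto simp: params_def)
qed

section \<open>Too few factors: counting parameters\<close>

interpretation fun_space: vector_space "\<lambda>(c::complex) (f::'t \<Rightarrow> complex) t. c * f t"
  by unfold_locales (auto simp: fun_eq_iff ring_distribs)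

lemma sum_fun_apply: "(\<Sum>i\<in>I. f i) t = (\<Sum>i\<in>I. f i t)" for f :: "'i \<Rightarrow> 't \<Rightarrow> complex"
  by (induction I rule: infinite_finite_induct) auto

text \<open>
  Stated for a family because different monomials may become equal when they are written in parameters.
\<close>

lemma fun_space_family_dependent:
  fixes G :: "'i \<Rightarrow> 't \<Rightarrow> complex"
  assumes "finite T" "finite E" "card T < card E" "\<And>i. i \<in> E \<Longrightarrow> G i \<in> fun_space.span T"
  shows "\<exists>c. (\<exists>i\<in>E. c i \<noteq> 0) \<and> (\<forall>t. (\<Sum>i\<in>E. c i * G i t) = 0)"
proof (cases "inj_on G E")
  case True
  have "fun_space.dependent (G ` E)"
  proof (rule ccontr)
    assume "\<not> fun_space.dependent (G ` E)"
    then have "card (G ` E) \<le> card T"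
      using fun_space.independent_span_bound[OF assms(1), of "G ` E"] assms(4) by blast
    then show False using card_image[OF True] assms(3) by simp
  qed
  then obtain u where u: "\<exists>v\<in>G ` E. u v \<noteq> 0" "(\<Sum>v\<in>G ` E. (\<lambda>t. u v * v t)) = 0"
    using fun_space.dependent_finite[of "G ` E"] assms(2) by auto
  have "(\<Sum>i\<in>E. u (G i) * G i t) = 0" for t
    using fun_cong[OF u(2), of t] sum.reindex[OF True, of "\<lambda>v. u v * v t"]
    by (simp add: sum_fun_apply)
  then show ?thesis using u(1) by (intro exI[of _ "\<lambda>i. u (G i)"]) auto
next
  case False
  \<comment> \<open>A repeated member of the family gives a relation at once.\<close>
  then obtain i j where ij: "i \<in> E" "j \<in> E" "i \<noteq> j" "G i = G j" by (auto simp: inj_on_def)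
  have "(\<Sum>k\<in>E. (if k = i then 1 else if k = j then -1 else 0) * G k t) =
    (\<Sum>k\<in>{i, j}. (if k = i then 1 else if k = j then -1 else 0) * G k t)" for t
    using assms(2) ij by (intro sum.mono_neutral_right) auto
  then show ?thesis using ij
    by (intro exI[of _ "\<lambda>k. if k = i then 1 else if k = j then -1 else 0"]) auto
qed

definition monomial_fun :: "'v set \<Rightarrow> ('v \<Rightarrow> nat) \<Rightarrow> ('v \<Rightarrow> complex) \<Rightarrow> complex" where
  "monomial_fun V e t = (\<Prod>v\<in>V. t v ^ e v)"

text \<open>
  The degree is bounded in each variable separately, which makes dimensions easy to bound: \<open>(k + 1) ^ card V\<close>.
\<close>

definition degree_space :: "'v set \<Rightarrow> nat \<Rightarrow> (('v \<Rightarrow> complex) \<Rightarrow> complex) set" where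
  "degree_space V k = fun_space.span (monomial_fun V ` (V \<rightarrow>\<^sub>E {..k}))"

lemma monomial_fun_in:
  assumes "\<And>v. v \<in> V \<Longrightarrow> e v \<le> k"
  shows "monomial_fun V e \<in> degree_space V k"
proof -
  have "monomial_fun V e = monomial_fun V (restrict e V)"
    by (auto simp: monomial_fun_def fun_eq_iff intro!: prod.cong)
  moreover have "restrict e V \<in> V \<rightarrow>\<^sub>E {..k}" using assms by auto
  ultimately show ?thesis unfolding degree_space_def by (metis fun_space.span_base imageI)
qed

lemma degree_space_mono: "k \<le> l \<Longrightarrow> f \<in> degree_space V k \<Longrightarrow> f \<in> degree_space V l"
  unfolding degree_space_def
  using fun_space.span_mono[of "monomial_fun V ` (V \<rightarrow>\<^sub>E {..k})" "monomial_fun V ` (V \<rightarrow>\<^sub>E {..l})"]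
    image_mono[OF PiE_mono[of V "\<lambda>_. {..k}" "\<lambda>_. {..l}"], of "monomial_fun V"] by auto

lemma degree_space_sum:
  assumes "\<And>i. i \<in> I \<Longrightarrow> f i \<in> degree_space V k"
  shows "(\<lambda>t. \<Sum>i\<in>I. f i t) \<in> degree_space V k"
proof -
  have "(\<lambda>t. \<Sum>i\<in>I. f i t) = sum f I" by (simp add: fun_eq_iff sum_fun_apply)
  then show ?thesis using assms unfolding degree_space_def by (simp add: fun_space.span_sum)
qed

lemma degree_space_const: "(\<lambda>t. c) \<in> degree_space V 0"
proof -
  have "monomial_fun V (\<lambda>_. 0) \<in> degree_space V 0" by (rule monomial_fun_in) simp
  from fun_space.span_scale[OF this[unfolded degree_space_def], of c]
  show ?thesis by (simp add: degree_space_def monomial_fun_def)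
qed

lemma degree_space_coord:
  assumes "finite V" "v \<in> V"
  shows "(\<lambda>t. t v) \<in> degree_space V 1"
proof -
  have "t v = monomial_fun V (\<lambda>u. if u = v then 1 else 0) t" for t :: "'a \<Rightarrow> complex"
  proof -
    have "monomial_fun V (\<lambda>u. if u = v then 1 else 0) t = (\<Prod>u\<in>V. if u = v then t u else 1)"
      unfolding monomial_fun_def by (intro prod.cong) auto
    then show ?thesis using assms by simp
  qed
  then have "(\<lambda>t. t v) = monomial_fun V (\<lambda>u. if u = v then 1 else 0)" by (auto simp: fun_eq_iff)
  then show ?thesis by (simp only:) (rule monomial_fun_in, simp)
qed

lemma degree_space_mult:
  assumes "f \<in> degree_space V k" "g \<in> degree_space V l"
  shows "(\<lambda>t. f t * g t) \<in> degree_space V (k + l)"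
proof -
  let ?S = "degree_space V (k + l)"
  have S: "0 \<in> ?S" "\<And>x y. x \<in> ?S \<Longrightarrow> y \<in> ?S \<Longrightarrow> x + y \<in> ?S"
    "\<And>c x. x \<in> ?S \<Longrightarrow> (\<lambda>t. c * x t) \<in> ?S"
    unfolding degree_space_def
    using fun_space.span_zero fun_space.span_add fun_space.span_scale by auto
  have mono: "(\<lambda>t. monomial_fun V e t * g t) \<in> ?S" if e: "e \<in> V \<rightarrow>\<^sub>E {..k}" for e
    using assms(2) unfolding degree_space_def[of V l]
  proof (induction g rule: fun_space.span_induct_alt)
    case base
    show ?case using S(1) by (simp add: zero_fun_def)
  next
    case (step c x y)
    then obtain e' where e': "x = monomial_fun V e'" "e' \<in> V \<rightarrow>\<^sub>E {..l}" by auto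
    have "(\<lambda>t. monomial_fun V e t * x t) = monomial_fun V (\<lambda>v. e v + e' v)"
      unfolding e'(1) by (auto simp: fun_eq_iff monomial_fun_def power_add prod.distrib)
    moreover have "monomial_fun V (\<lambda>v. e v + e' v) \<in> ?S"
      using e e'(2) by (intro monomial_fun_in add_mono) auto
    ultimately have "(\<lambda>t. c * (monomial_fun V e t * x t)) + (\<lambda>t. monomial_fun V e t * y t) \<in> ?S"
      using step by (intro S) auto
    then show ?case by (simp add: plus_fun_def ring_distribs mult.left_commute)
  qed
  show ?thesis
    using assms(1) unfolding degree_space_def[of V k]
  proof (induction f rule: fun_space.span_induct_alt)
    case base
    show ?case using S(1) by (simp add: zero_fun_def)
  next
    case (step c x y)
    then have "(\<lambda>t. c * (x t * g t)) + (\<lambda>t. y t * g t) \<in> ?S"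
      using mono by (intro S) auto
    then show ?case by (simp add: plus_fun_def ring_distribs mult.assoc)
  qed
qed

lemma degree_space_power:
  assumes "f \<in> degree_space V k"
  shows "(\<lambda>t. f t ^ m) \<in> degree_space V (m * k)"
proof (induction m)
  case 0
  show ?case by (simp add: degree_space_const)
next
  case (Suc m)
  then show ?case using degree_space_mult[OF assms Suc] by simp
qed

lemma degree_space_prod:
  assumes "finite I" "\<And>i. i \<in> I \<Longrightarrow> f i \<in> degree_space V k"
  shows "(\<lambda>t. \<Prod>i\<in>I. f i t) \<in> degree_space V (card I * k)"
  using assms
proof (induction I rule: finite_induct)
  case empty
  show ?case by (simp add: degree_space_const)
next
  case (insert i I)
  then show ?case using degree_space_mult[of "f i" V k "\<lambda>t. \<Prod>i\<in>I. f i t" "card I * k"] by simp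
qed

lemma param_product_degree_space:
  assumes "a < n" "b < n" "set is \<subseteq> set js"
  shows "(\<lambda>t. param_product n is t $$ (a, b)) \<in> degree_space (params n js) (length is)"
  using assms(1,3)
proof (induction "is" arbitrary: a)
  case Nil
  then show ?case using assms(2) by (auto simp: param_product_simps intro: degree_space_const)
next
  case (Cons i "is")
  have fin: "finite (params n js)" by (simp add: params_def)
  have "(\<lambda>t. \<Sum>l<n. t (i, int l - int a) * param_product n is t $$ (l, b)) \<in>
      degree_space (params n js) (1 + length is)"
    using Cons by (intro degree_space_sum degree_space_mult degree_space_coord fin) (auto simp: params_def)
  then show ?case unfolding param_product_entry[OF Cons.prems(1) assms(2)] by simp
qed

text \<open>
  By induction on the variables: a nonzero polynomial in one variable, whose coefficients are
  polynomials in the others evaluated at a suitable point, has a non-root.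
\<close>

lemma monomials_independent:
  fixes c :: "('v \<Rightarrow> nat) \<Rightarrow> complex"
  assumes "finite I" "\<exists>e\<in>I \<rightarrow>\<^sub>E {..D}. c e \<noteq> 0"
  shows "\<exists>x. (\<Sum>e\<in>I \<rightarrow>\<^sub>E {..D}. c e * monomial_fun I e x) \<noteq> 0"
  using assms
proof (induction I arbitrary: c rule: finite_induct)
  case empty
  then show ?case by (auto simp: monomial_fun_def)
next
  case (insert v I)
  let ?E = "I \<rightarrow>\<^sub>E {..D}"
  \<comment> \<open>Collect the powers of the new variable: \<open>S k\<close> is the coefficient of its \<open>k\<close>-th power.\<close>
  define S where "S = (\<lambda>k x. \<Sum>e\<in>?E. c (e(v := k)) * monomial_fun I e x)"
  obtain k0 e0 where "k0 \<le> D" "e0 \<in> ?E" "c (e0(v := k0)) \<noteq> 0"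
    using insert.prems unfolding PiE_insert_eq by auto
  then obtain x where x: "S k0 x \<noteq> 0"
    using insert.IH[of "\<lambda>e. c (e(v := k0))"] unfolding S_def by blast
  define p where "p = (\<Sum>k\<le>D. monom (S k x) k)"
  have "coeff p k0 \<noteq> 0" using x \<open>k0 \<le> D\<close> by (simp add: p_def coeff_sum)
  then have "p \<noteq> 0" by auto
  then have "finite {y. poly p y = 0}" by (rule poly_roots_finite)
  then obtain y where y: "poly p y \<noteq> 0"
    using infinite_UNIV_char_0[where 'a = complex] by (metis (mono_tags, lifting) UNIV_eq_I mem_Collect_eq)
  have "(\<Sum>e\<in>insert v I \<rightarrow>\<^sub>E {..D}. c e * monomial_fun (insert v I) e (x(v := y))) =
    (\<Sum>(k, e)\<in>{..D} \<times> ?E. c (e(v := k)) * monomial_fun (insert v I) (e(v := k)) (x(v := y)))"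
    unfolding PiE_insert_eq using insert.hyps(2)
    by (subst sum.reindex[OF inj_combinator]) (auto simp: case_prod_unfold comp_def)
  also have "\<dots> = (\<Sum>(k, e)\<in>{..D} \<times> ?E. y ^ k * (c (e(v := k)) * monomial_fun I e x))"
  proof (intro sum.cong refl, clarify)
    fix k e
    have "monomial_fun (insert v I) (e(v := k)) (x(v := y)) = y ^ k * monomial_fun I e x"
    proof -
      have "(\<Prod>u\<in>I. (x(v := y)) u ^ (e(v := k)) u) = (\<Prod>u\<in>I. x u ^ e u)"
      proof (intro prod.cong refl)
        fix u assume "u \<in> I"
        then have "u \<noteq> v" using insert.hyps by auto
        then show "(x(v := y)) u ^ (e(v := k)) u = x u ^ e u" by simp
      qed
      then show ?thesis using insert.hyps by (simp add: monomial_fun_def)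
    qed
    then show "c (e(v := k)) * monomial_fun (insert v I) (e(v := k)) (x(v := y)) =
      y ^ k * (c (e(v := k)) * monomial_fun I e x)" by simp
  qed
  also have "\<dots> = (\<Sum>k\<le>D. y ^ k * S k x)"
    by (simp add: sum.cartesian_product[symmetric] S_def sum_distrib_left)
  also have "\<dots> = poly p y" by (simp add: p_def poly_sum poly_monom mult.commute)
  finally show ?case using y by metis
qed

text \<open>
  Products of \<open>s \<le> n div 2\<close> Toeplitz matrices have \<open>s * (2 * n - 1) < n * n\<close> parameters. Hence the monomials
  in the \<open>n * n\<close> entries, of degree at most \<open>D\<close> in each, become linearly dependent when they are written in the
  parameters, once \<open>D\<close> is large; a dependency is an equation of the image.
\<close>

lemma few_toeplitz_hypersurface:
  assumes n: "n \<ge> 1" and s: "s \<le> n div 2"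
  shows "\<exists>P\<in>poly_funs n. (\<forall>A. product_of_toeplitz n s A \<longrightarrow> P A = 0) \<and> (\<exists>M\<in>carrier_mat n n. P M \<noteq> 0)"
proof -
  define V where "V = params n [0..<s]"
  define I where "I = {..<n} \<times> {..<n}"
  \<comment> \<open>Monomials of degree at most \<open>D\<close> in each entry become polynomials of degree at most \<open>K\<close> in each
    parameter; \<open>D\<close> is chosen so that \<open>(K + 1) ^ card V < (D + 1) ^ (n * n)\<close>.\<close>
  define q where "q = n * n * s + 1"
  define D where "D = q ^ card V"
  define F where "F = param_product n [0..<s]"
  define G where "G = (\<lambda>e t. \<Prod>v\<in>I. F t $$ v ^ e v)"
  define K where "K = n * n * (D * s)"
  have fV: "finite V" and cV: "card V = s * (2 * n - 1)"
    using n by (auto simp: V_def params_def card_cartesian_product nat_diff_distrib)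
  have fI: "finite I" and cI: "card I = n * n" by (auto simp: I_def)
  have "2 * s * (2 * n - 1) \<le> n * (2 * n - 1)" using s by (intro mult_right_mono) auto
  also have "\<dots> < 2 * (n * n)" using n by (cases n) auto
  finally have few: "card V < n * n" by (simp add: cV)
  have mem: "G e \<in> degree_space V K" if e: "e \<in> I \<rightarrow>\<^sub>E {..D}" for e
    unfolding G_def K_def cI[symmetric]
  proof (rule degree_space_prod[OF fI])
    fix v assume v: "v \<in> I"
    then obtain a b where ab: "v = (a, b)" "a < n" "b < n" by (auto simp: I_def)
    have "(\<lambda>t. F t $$ v) \<in> degree_space V (length [0..<s])"
      unfolding F_def V_def ab(1) by (intro param_product_degree_space ab) simp
    from degree_space_power[OF this, of "e v"]
    have "(\<lambda>t. F t $$ v ^ e v) \<in> degree_space V (e v * s)" by simp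
    moreover have "e v \<le> D" using e v by auto
    ultimately show "(\<lambda>t. F t $$ v ^ e v) \<in> degree_space V (D * s)"
      using degree_space_mono[of "e v * s" "D * s"] by simp
  qed
  let ?T = "monomial_fun V ` (V \<rightarrow>\<^sub>E {..K})"
  have fT: "finite ?T" using fV by (intro finite_imageI finite_PiE) auto
  have "card ?T \<le> card (V \<rightarrow>\<^sub>E {..K})"
    using fV by (intro card_image_le finite_PiE) auto
  also have "\<dots> = (K + 1) ^ card V" by (simp add: card_PiE[OF fV])
  also have "\<dots> \<le> (q * (D + 1)) ^ card V"
    by (intro power_mono) (simp_all add: K_def q_def algebra_simps)
  also have "\<dots> = D * (D + 1) ^ card V" by (simp only: power_mult_distrib D_def[symmetric])
  also have "\<dots> < (D + 1) ^ Suc (card V)" by simp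
  also have "\<dots> \<le> (D + 1) ^ (n * n)" using few by (intro power_increasing) auto
  also have "\<dots> = card (I \<rightarrow>\<^sub>E {..D})" by (simp add: card_PiE[OF fI] cI)
  finally have less: "card ?T < card (I \<rightarrow>\<^sub>E {..D})" .
  have "\<exists>c. (\<exists>e\<in>I \<rightarrow>\<^sub>E {..D}. c e \<noteq> 0) \<and> (\<forall>t. (\<Sum>e\<in>I \<rightarrow>\<^sub>E {..D}. c e * G e t) = 0)"
  proof (rule fun_space_family_dependent[OF fT _ less])
    show "finite (I \<rightarrow>\<^sub>E {..D})" by (rule finite_PiE[OF fI]) simp
    show "G e \<in> fun_space.span ?T" if "e \<in> I \<rightarrow>\<^sub>E {..D}" for e
      using mem[OF that] by (simp only: degree_space_def)
  qed
  then obtain c where c: "\<exists>e\<in>I \<rightarrow>\<^sub>E {..D}. c e \<noteq> 0" "\<And>t. (\<Sum>e\<in>I \<rightarrow>\<^sub>E {..D}. c e * G e t) = 0"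
    by blast
  define P where "P = (\<lambda>A :: complex mat. \<Sum>e\<in>I \<rightarrow>\<^sub>E {..D}. c e * (\<Prod>v\<in>I. A $$ v ^ e v))"
  have "P \<in> poly_funs n"
    unfolding P_def
    by (intro poly_funs_sum poly_funs.mult poly_funs.const poly_funs_prod poly_funs_power)
       (auto simp: I_def intro: poly_funs.entry)
  moreover have "P A = 0" if A: "product_of_toeplitz n s A" for A
  proof -
    obtain t where "A = F t" using A unfolding product_of_toeplitz_iff_param F_def by blast
    then have "P A = (\<Sum>e\<in>I \<rightarrow>\<^sub>E {..D}. c e * G e t)" by (simp only: P_def G_def)
    then show ?thesis by (simp only: c(2))
  qed
  moreover have "\<exists>M\<in>carrier_mat n n. P M \<noteq> 0"
  proof -
    obtain x where x: "(\<Sum>e\<in>I \<rightarrow>\<^sub>E {..D}. c e * monomial_fun I e x) \<noteq> 0"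
      using monomials_independent[OF fI c(1)] by blast
    have entries: "(\<Prod>v\<in>I. mat n n x $$ v ^ e v) = (\<Prod>v\<in>I. x v ^ e v)" for e
      by (intro prod.cong refl) (auto simp: I_def)
    have "P (mat n n x) = (\<Sum>e\<in>I \<rightarrow>\<^sub>E {..D}. c e * monomial_fun I e x)"
      by (simp only: P_def monomial_fun_def entries)
    then show ?thesis using x by (intro bexI[of _ "mat n n x"]) auto
  qed
  ultimately show ?thesis by blast
qed

section \<open>Directions reached by degenerating products\<close>

definition mat_bound :: "nat \<Rightarrow> real \<Rightarrow> complex mat \<Rightarrow> bool" where
  "mat_bound n C M \<longleftrightarrow> 0 \<le> C \<and> M \<in> carrier_mat n n \<and> (\<forall>i<n. \<forall>j<n. norm (M $$ (i, j)) \<le> C)"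

lemma mat_bound_carrier: "mat_bound n C M \<Longrightarrow> M \<in> carrier_mat n n"
  by (simp add: mat_bound_def)

lemma mat_bound_exists:
  assumes "M \<in> carrier_mat n n"
  shows "\<exists>C. mat_bound n C M"
proof (intro exI)
  let ?C = "\<Sum>i<n. \<Sum>j<n. norm (M $$ (i, j))"
  have "norm (M $$ (i, j)) \<le> ?C" if "i < n" "j < n" for i j
  proof -
    have "norm (M $$ (i, j)) \<le> (\<Sum>j<n. norm (M $$ (i, j)))"
      using that by (intro member_le_sum) auto
    also have "\<dots> \<le> ?C"
      using that by (intro member_le_sum[where f = "\<lambda>i. \<Sum>j<n. norm (M $$ (i, j))"]) (auto intro: sum_nonneg)
    finally show ?thesis .
  qed
  then show "mat_bound n ?C M" using assms by (auto simp: mat_bound_def intro!: sum_nonneg)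
qed

lemma mat_bound_add:
  assumes "mat_bound n C A" "mat_bound n D B"
  shows "mat_bound n (C + D) (A + B)"
  using assms by (auto simp: mat_bound_def intro!: norm_triangle_le add_mono)

lemma mat_bound_smult:
  assumes "mat_bound n C A"
  shows "mat_bound n (norm c * C) (c \<cdot>\<^sub>m A)"
  using assms by (auto simp: mat_bound_def norm_mult intro!: mult_left_mono)

lemma mat_bound_mono:
  assumes "mat_bound n C A" "C \<le> D"
  shows "mat_bound n D A"
  using assms by (force simp: mat_bound_def)

lemma mat_bound_smult_le1:
  assumes "mat_bound n C A" "norm c \<le> 1"
  shows "mat_bound n C (c \<cdot>\<^sub>m A)"
  using assms by (intro mat_bound_mono[OF mat_bound_smult]) (auto simp: mat_bound_def intro: mult_left_le_one_le)

lemma mat_bound_mult: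
  assumes "mat_bound n C A" "mat_bound n D B"
  shows "mat_bound n (n * (C * D)) (A * B)"
  unfolding mat_bound_def
proof (intro conjI allI impI)
  fix i j assume ij: "i < n" "j < n"
  have "norm (\<Sum>k<n. A $$ (i, k) * B $$ (k, j)) \<le> (\<Sum>k<n. C * D)"
    using assms ij by (intro sum_norm_le) (auto simp: mat_bound_def norm_mult intro!: mult_mono)
  then show "norm ((A * B) $$ (i, j)) \<le> n * (C * D)"
    using assms ij by (auto simp: mat_bound_def scalar_prod_def atLeast0LessThan)
qed (use assms in \<open>auto simp: mat_bound_def\<close>)

lemma poly_entries_bound:
  assumes "poly_entries n A"
  shows "\<exists>C. \<forall>e. norm e \<le> 1 \<longrightarrow> mat_bound n C (A e)"
proof -
  obtain p where p: "\<And>i j e. i < n \<Longrightarrow> j < n \<Longrightarrow> A e $$ (i, j) = poly (p i j) e"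
    using assms unfolding poly_entries_def by metis
  define M where "M = mat n n (\<lambda>(i, j). complex_of_real (\<Sum>k\<le>degree (p i j). norm (coeff (p i j) k)))"
  obtain C where C: "mat_bound n C M" using mat_bound_exists[of M n] by (auto simp: M_def)
  have "norm (A e $$ (i, j)) \<le> C" if "norm e \<le> 1" "i < n" "j < n" for e i j
  proof -
    have "norm (A e $$ (i, j)) \<le> (\<Sum>k\<le>degree (p i j). norm (coeff (p i j) k))"
      unfolding p[OF that(2,3)] poly_altdef using that(1)
      by (intro sum_norm_le) (auto simp: norm_mult norm_power intro!: mult_right_le_one_le power_le_one)
    also have "\<dots> = norm (M $$ (i, j))"
      using that by (simp add: M_def sum_nonneg del: of_real_sum)
    also have "\<dots> \<le> C" using C that by (auto simp: mat_bound_def)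
    finally show ?thesis .
  qed
  then show ?thesis using assms C by (intro exI[of _ C]) (auto simp: mat_bound_def poly_entries_def)
qed

text \<open>
  For \<open>k \<ge> 1\<close>, in terms of the nilpotent shift \<open>N\<close> this is \<open>N ^ k\<close> plus the \<open>k\<close>-th power of the transpose of \<open>N\<close>.
\<close>

definition shift_sum :: "nat \<Rightarrow> nat \<Rightarrow> complex mat" where
  "shift_sum n k = toep n (\<lambda>d. if d = int k \<or> d = - int k then 1 else 0)"

text \<open>
  The sums \<open>Y\<^sub>0 + S\<^sub>1 Y\<^sub>1 + \<dots> + S\<^sub>k Y\<^sub>k\<close> with Toeplitz \<open>Y\<^sub>i\<close> and \<open>S\<^sub>i = shift_sum n i\<close>. The bound on the entries of
  the \<open>Y\<^sub>i\<close> is recorded because the error terms below must be uniform in the direction.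
\<close>

primrec directions :: "nat \<Rightarrow> nat \<Rightarrow> real \<Rightarrow> complex mat set" where
  "directions n 0 C = {Y. toeplitz n Y \<and> mat_bound n C Y}"
| "directions n (Suc k) C =
     {Z + shift_sum n (Suc k) * Y | Z Y. Z \<in> directions n k C \<and> toeplitz n Y \<and> mat_bound n C Y}"

lemma shift_sum_carrier [simp]: "shift_sum n k \<in> carrier_mat n n"
  by (simp add: shift_sum_def)

lemma directions_carrier: "Z \<in> directions n k C \<Longrightarrow> Z \<in> carrier_mat n n"
  by (induction k arbitrary: Z)
    (auto simp: toeplitz_carrier intro!: add_carrier_mat mult_carrier_mat[of _ n n _ n])

lemma directions_bound: "\<exists>C'. \<forall>Z\<in>directions n k C. mat_bound n C' Z"
proof (induction k)
  case 0
  show ?case by auto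
next
  case (Suc k)
  then obtain C' where "\<forall>Z\<in>directions n k C. mat_bound n C' Z" by auto
  moreover obtain D where "mat_bound n D (shift_sum n (Suc k))"
    using mat_bound_exists[OF shift_sum_carrier] by blast
  ultimately show ?case
    by (intro exI[of _ "C' + n * (D * C)"]) (auto intro!: mat_bound_add mat_bound_mult)
qed

lemma directions_smult:
  assumes "Z \<in> directions n k C"
  shows "c \<cdot>\<^sub>m Z \<in> directions n k (norm c * C)"
  using assms
proof (induction k arbitrary: Z)
  case 0
  then show ?case by (auto intro: toeplitz_smult mat_bound_smult)
next
  case (Suc k)
  then obtain W Y where Z: "Z = W + shift_sum n (Suc k) * Y" "W \<in> directions n k C"
    "toeplitz n Y" "mat_bound n C Y" by auto
  have "c \<cdot>\<^sub>m Z = c \<cdot>\<^sub>m W + shift_sum n (Suc k) * (c \<cdot>\<^sub>m Y)"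
    using directions_carrier[OF Z(2)] toeplitz_carrier[OF Z(3)]
    unfolding Z(1) by (subst mult_smult_distrib[of _ n n _ n]) (auto intro!: add_smult_distrib_left_mat[of _ n n] mult_carrier_mat[of _ n n _ n])
  then show ?case
    using Suc.IH[OF Z(2)] toeplitz_smult[OF Z(3)] mat_bound_smult[OF Z(4)] by auto
qed

lemma directions_add:
  assumes "Z \<in> directions n k C" "Z' \<in> directions n k D"
  shows "Z + Z' \<in> directions n k (C + D)"
  using assms
proof (induction k arbitrary: Z Z')
  case 0
  then show ?case by (auto intro: toeplitz_add mat_bound_add)
next
  case (Suc k)
  obtain W Y where Z: "Z = W + shift_sum n (Suc k) * Y" "W \<in> directions n k C"
    "toeplitz n Y" "mat_bound n C Y" using Suc.prems(1) by auto
  obtain W' Y' where Z': "Z' = W' + shift_sum n (Suc k) * Y'" "W' \<in> directions n k D"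
    "toeplitz n Y'" "mat_bound n D Y'" using Suc.prems(2) by auto
  note c = directions_carrier[OF Z(2)] toeplitz_carrier[OF Z(3)]
    directions_carrier[OF Z'(2)] toeplitz_carrier[OF Z'(3)]
  have m: "shift_sum n (Suc k) * (Y + Y') = shift_sum n (Suc k) * Y + shift_sum n (Suc k) * Y'"
    using c by (intro mult_add_distrib_mat[of _ n n _ n]) auto
  have "Z + Z' = (W + W') + shift_sum n (Suc k) * (Y + Y')"
    unfolding m Z(1) Z'(1) using c
    by (intro eq_matI) (auto simp: carrier_matD[OF shift_sum_carrier] simp del: index_mult_mat(1))
  then show ?case
    using Suc.IH[OF Z(2) Z'(2)] toeplitz_add[OF Z(3) Z'(3)] mat_bound_add[OF Z(4) Z'(4)] by auto
qed

lemma directions_Suc_superset: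
  assumes "Z \<in> directions n k C" "0 \<le> C"
  shows "Z \<in> directions n (Suc k) C"
proof -
  have "Z = Z + shift_sum n (Suc k) * 0\<^sub>m n n" using directions_carrier[OF assms(1)] by (simp add: right_mult_zero_mat[OF shift_sum_carrier])
  moreover have "mat_bound n C (0\<^sub>m n n)" using assms(2) by (auto simp: mat_bound_def)
  ultimately show ?thesis using assms(1) toeplitz_zero by auto
qed

lemma directions_mono:
  assumes "Z \<in> directions n k C" "C \<le> D"
  shows "Z \<in> directions n k D"
  using assms(1)
proof (induction k arbitrary: Z)
  case 0
  then show ?case using assms(2) by (auto intro: mat_bound_mono)
next
  case (Suc k)
  then obtain W Y where Z: "Z = W + shift_sum n (Suc k) * Y" "W \<in> directions n k C"
    "toeplitz n Y" "mat_bound n C Y" by auto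
  then show ?case using Suc.IH[OF Z(2)] mat_bound_mono[OF Z(4) assms(2)] by auto
qed

lemma directions_toeplitz:
  assumes "toeplitz n Y" "mat_bound n C Y"
  shows "Y \<in> directions n k C"
proof (induction k)
  case 0
  show ?case using assms by simp
next
  case (Suc k)
  then show ?case using assms(2) by (intro directions_Suc_superset) (simp_all add: mat_bound_def)
qed

text \<open>
  The computation behind the degeneration. The terms of order \<open>e ^ (2 * K)\<close> are \<open>- Y\<close> from the first factor
  and \<open>Y\<close> from the second, and they cancel. At order \<open>e ^ (2 * K + 1)\<close> there remain the contribution \<open>S * Y\<close>, of the
  second \<open>Y\<close> multiplied by \<open>S\<close>, and the old direction \<open>Z\<close>. Taking the second factor at \<open>e\<^sup>2\<close> makes its distance from
  the identity negligible against \<open>e S\<close>.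
\<close>

lemma perturbed_product:
  assumes c: "S \<in> carrier_mat n n" "X \<in> carrier_mat n n" "Y \<in> carrier_mat n n"
    "Z \<in> carrier_mat n n" "B \<in> carrier_mat n n" and K: "K \<ge> 1"
  shows "(1\<^sub>m n + e \<cdot>\<^sub>m S + (- (e ^ (2 * K))) \<cdot>\<^sub>m Y) *
      (1\<^sub>m n + (e\<^sup>2) \<cdot>\<^sub>m X + ((e\<^sup>2) ^ K) \<cdot>\<^sub>m (Y + e \<cdot>\<^sub>m Z + (e\<^sup>2) \<cdot>\<^sub>m B)) =
    1\<^sub>m n + (e::complex) \<cdot>\<^sub>m (S + e \<cdot>\<^sub>m X + (e\<^sup>2) \<cdot>\<^sub>m (S * X)) + (e ^ (2 * K + 1)) \<cdot>\<^sub>m (Z + S * Y +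
      e \<cdot>\<^sub>m (B + S * Z + e \<cdot>\<^sub>m (S * B) + (-1) \<cdot>\<^sub>m (Y * X) +
        (- (e ^ (2 * K - 2))) \<cdot>\<^sub>m (Y * (Y + e \<cdot>\<^sub>m Z + (e\<^sup>2) \<cdot>\<^sub>m B))))"
proof -
  let ?P = "1\<^sub>m n + (e\<^sup>2) \<cdot>\<^sub>m X + ((e\<^sup>2) ^ K) \<cdot>\<^sub>m (Y + e \<cdot>\<^sub>m Z + (e\<^sup>2) \<cdot>\<^sub>m B)"
  let ?U = "Y + e \<cdot>\<^sub>m Z + (e\<^sup>2) \<cdot>\<^sub>m B"
  have P: "?P \<in> carrier_mat n n" "?U \<in> carrier_mat n n" using c by auto
  have 1: "(1\<^sub>m n + e \<cdot>\<^sub>m S + (- (e ^ (2 * K))) \<cdot>\<^sub>m Y) * Q =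
     Q + e \<cdot>\<^sub>m (S * Q) + (- (e ^ (2 * K))) \<cdot>\<^sub>m (Y * Q)" if "Q \<in> carrier_mat n n" for Q
    using c that
    by (simp add: add_mult_distrib_mat[of _ n n _ _ n] mult_smult_assoc_mat[of _ n n _ n] del: assoc_add_mat)
  have 2: "M * (1\<^sub>m n + (e\<^sup>2) \<cdot>\<^sub>m X + ((e\<^sup>2) ^ K) \<cdot>\<^sub>m U) = M + (e\<^sup>2) \<cdot>\<^sub>m (M * X) + ((e\<^sup>2) ^ K) \<cdot>\<^sub>m (M * U)"
    if "M \<in> carrier_mat n n" "U \<in> carrier_mat n n" for M U
    using c that
    by (simp add: mult_add_distrib_mat[of _ n n _ n] mult_smult_distrib[of _ n n _ n] del: assoc_add_mat)
  have 3: "S * ?U = S * Y + e \<cdot>\<^sub>m (S * Z) + (e\<^sup>2) \<cdot>\<^sub>m (S * B)"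
    using c by (simp add: mult_add_distrib_mat[of _ n n _ n] mult_smult_distrib[of _ n n _ n] del: assoc_add_mat)
  define W where "W = Y * ?U"
  define SY SZ SB SX YX where p: "SY = S * Y" "SZ = S * Z" "SB = S * B" "SX = S * X" "YX = Y * X"
  have c': "W \<in> carrier_mat n n" "SY \<in> carrier_mat n n" "SZ \<in> carrier_mat n n" "SB \<in> carrier_mat n n"
    "SX \<in> carrier_mat n n" "YX \<in> carrier_mat n n"
    using c P(2) unfolding p W_def by (auto intro!: mult_carrier_mat[of _ n n _ n])
  obtain J where J: "K = Suc J" using K by (cases K) auto
  define q where "q = e ^ (2 * J)"
  have q: "e ^ (2 * K) = q * (e * e)" "(e\<^sup>2) ^ K = q * (e * e)" "e ^ (2 * K + 1) = q * (e * e * e)"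
    "e ^ (2 * K - 2) = q"
    by (simp_all add: J q_def mult_2 mult_2_right power_add power2_eq_square power_mult_distrib mult_ac)
  show ?thesis
    unfolding 1[OF P(1)] 2[OF c(1) P(2)] 2[OF c(3) P(2)] 3
    unfolding W_def[symmetric] p[symmetric] q
    unfolding power2_eq_square
    using c c'
  proof (intro eq_matI, goal_cases)
    case (1 i j)
    then show ?case by simp (simp add: ring_distribs mult_ac)
  qed simp_all
qed

text \<open>
  Products of \<open>k + 1\<close> Toeplitz matrices reach, from a polynomial curve of base points through the identity,
  every direction of \<open>directions n k\<close>, to leading order \<open>e ^ K\<close> and with a uniformly bounded error. This is a
  substitute for computing the differential of the multiplication map: only its limit as \<open>e \<rightarrow> 0\<close> is
  needed. Each step adds one factor by \<open>perturbed_product\<close>.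
\<close>

lemma degenerating_products:
  "\<exists>A K. K \<ge> 1 \<and> poly_entries n A \<and> (\<forall>C. \<exists>C'. \<forall>e Z. norm e \<le> 1 \<longrightarrow> Z \<in> directions n k C \<longrightarrow>
    (\<exists>B. mat_bound n C' B \<and>
      product_of_toeplitz n (Suc k) (1\<^sub>m n + e \<cdot>\<^sub>m A e + (e ^ K) \<cdot>\<^sub>m (Z + e \<cdot>\<^sub>m B))))"
proof (induction k)
  case 0
  show ?case
  proof (intro exI[of _ "\<lambda>e. 0\<^sub>m n n"] exI[of _ 1] conjI allI exI[of _ 0] impI
      exI[of _ "0\<^sub>m n n"])
    fix e :: complex and Z C assume "Z \<in> directions n 0 C"
    then have Z: "toeplitz n Z" "Z \<in> carrier_mat n n" by (auto simp: toeplitz_carrier)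
    have "1\<^sub>m n + e \<cdot>\<^sub>m 0\<^sub>m n n + (e ^ 1) \<cdot>\<^sub>m (Z + e \<cdot>\<^sub>m 0\<^sub>m n n) = 1\<^sub>m n + e \<cdot>\<^sub>m Z"
      using Z by (intro eq_matI) auto
    then show "product_of_toeplitz n (Suc 0) (1\<^sub>m n + e \<cdot>\<^sub>m 0\<^sub>m n n + (e ^ 1) \<cdot>\<^sub>m (Z + e \<cdot>\<^sub>m 0\<^sub>m n n))"
      using Z(1) by (simp only:) (intro product_of_toeplitz_1 toeplitz_add toeplitz_smult toeplitz_one)
  qed (auto simp: mat_bound_def intro: poly_entries_const)
next
  case (Suc k)
  then obtain A K where K: "K \<ge> 1" and A: "poly_entries n A" and
    ex: "\<And>C. \<exists>C'. \<forall>e Z. norm e \<le> 1 \<longrightarrow> Z \<in> directions n k C \<longrightarrow>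
    (\<exists>B. mat_bound n C' B \<and>
      product_of_toeplitz n (Suc k) (1\<^sub>m n + e \<cdot>\<^sub>m A e + (e ^ K) \<cdot>\<^sub>m (Z + e \<cdot>\<^sub>m B)))" by blast
  define S where "S = shift_sum n (Suc k)"
  have S: "S \<in> carrier_mat n n" "toeplitz n S" by (simp_all add: S_def shift_sum_def)
  have Ac: "A e \<in> carrier_mat n n" for e using A by (simp add: poly_entries_def)
  define A' where "A' = (\<lambda>e. S + e \<cdot>\<^sub>m A (e\<^sup>2) + (e\<^sup>2) \<cdot>\<^sub>m (S * A (e\<^sup>2)))"
  have "poly_entries n (\<lambda>e. A (poly [:0, 0, 1:] e))" by (rule poly_entries_subst[OF A])
  then have A2: "poly_entries n (\<lambda>e. A (e\<^sup>2))" by (simp add: power2_eq_square)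
  have "poly_entries n (\<lambda>e. S + poly [:0, 1:] e \<cdot>\<^sub>m A (e\<^sup>2) + poly [:0, 0, 1:] e \<cdot>\<^sub>m (S * A (e\<^sup>2)))"
    by (intro poly_entries_add poly_entries_smult poly_entries_const_mult A2 poly_entries_const S)
  then have A': "poly_entries n A'" by (simp add: A'_def power2_eq_square)
  show ?case
  proof (intro exI[of _ A'] exI[of _ "2 * K + 1"] conjI allI A')
    fix C
    \<comment> \<open>The new product is formed from the old one at \<open>e\<^sup>2\<close>, with direction \<open>Y + e Z\<close>, so these bounds
      control every term that goes into the new error.\<close>
    obtain CA where CA: "\<And>e. norm e \<le> 1 \<Longrightarrow> mat_bound n CA (A e)"
      using poly_entries_bound[OF A] by blast
    obtain CS where CS: "mat_bound n CS S" using mat_bound_exists[OF S(1)] by blast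
    obtain CZ where CZ: "\<And>Z. Z \<in> directions n k C \<Longrightarrow> mat_bound n CZ Z"
      using directions_bound by blast
    obtain CB where CB: "\<And>e Z. norm e \<le> 1 \<Longrightarrow> Z \<in> directions n k (C + C) \<Longrightarrow>
      (\<exists>B. mat_bound n CB B \<and>
        product_of_toeplitz n (Suc k) (1\<^sub>m n + e \<cdot>\<^sub>m A e + (e ^ K) \<cdot>\<^sub>m (Z + e \<cdot>\<^sub>m B)))"
      using ex[of "C + C"] by blast
    define C' where "C' = CB + n * (CS * CZ) + n * (CS * CB) + n * (C * CA) + n * (C * (C + CZ + CB))"
    show "\<exists>C'. \<forall>e Z. norm e \<le> 1 \<longrightarrow> Z \<in> directions n (Suc k) C \<longrightarrow>
      (\<exists>B. mat_bound n C' B \<and> product_of_toeplitz n (Suc (Suc k))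
        (1\<^sub>m n + e \<cdot>\<^sub>m A' e + (e ^ (2 * K + 1)) \<cdot>\<^sub>m (Z + e \<cdot>\<^sub>m B)))"
    proof (intro exI[of _ C'] allI impI)
      fix e :: complex and Z' assume e: "norm e \<le> 1" and "Z' \<in> directions n (Suc k) C"
      then obtain Z Y where Z': "Z' = Z + S * Y" and Z: "Z \<in> directions n k C"
        and Y: "toeplitz n Y" "mat_bound n C Y" by (auto simp: S_def)
      note car = directions_carrier[OF Z] toeplitz_carrier[OF Y(1)]
      have e2: "norm (e\<^sup>2) \<le> 1" "norm (e ^ j) \<le> 1" for j
        using e by (auto simp: norm_power power_le_one)
      have C0: "0 \<le> C" using Y(2) by (simp add: mat_bound_def)
      have "e \<cdot>\<^sub>m Z \<in> directions n k (norm e * C)" by (rule directions_smult[OF Z])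
      then have "Y + e \<cdot>\<^sub>m Z \<in> directions n k (C + norm e * C)"
        by (rule directions_add[OF directions_toeplitz[OF Y]])
      then have "Y + e \<cdot>\<^sub>m Z \<in> directions n k (C + C)"
      proof (rule directions_mono)
        show "C + norm e * C \<le> C + C" using mult_left_le_one_le[OF C0 norm_ge_zero e] by linarith
      qed
      from CB[OF e2(1) this] obtain B where B: "mat_bound n CB B" and
        prod: "product_of_toeplitz n (Suc k)
          (1\<^sub>m n + (e\<^sup>2) \<cdot>\<^sub>m A (e\<^sup>2) + ((e\<^sup>2) ^ K) \<cdot>\<^sub>m (Y + e \<cdot>\<^sub>m Z + (e\<^sup>2) \<cdot>\<^sub>m B))" by blast
      note Bc = mat_bound_carrier[OF B]
      define B' where "B' = B + S * Z + e \<cdot>\<^sub>m (S * B) + (-1) \<cdot>\<^sub>m (Y * A (e\<^sup>2)) +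
        (- (e ^ (2 * K - 2))) \<cdot>\<^sub>m (Y * (Y + e \<cdot>\<^sub>m Z + (e\<^sup>2) \<cdot>\<^sub>m B))"
      have "toeplitz n (1\<^sub>m n + e \<cdot>\<^sub>m S + (- (e ^ (2 * K))) \<cdot>\<^sub>m Y)"
        by (intro toeplitz_add toeplitz_smult toeplitz_one S(2) Y(1))
      from product_of_toeplitz_Suc[OF this prod]
      have "product_of_toeplitz n (Suc (Suc k))
        (1\<^sub>m n + e \<cdot>\<^sub>m A' e + (e ^ (2 * K + 1)) \<cdot>\<^sub>m (Z' + e \<cdot>\<^sub>m B'))"
        unfolding A'_def B'_def Z' perturbed_product[OF S(1) Ac car(2,1) Bc K] .
      moreover have "mat_bound n C' B'"
        unfolding B'_def C'_def
        by (intro mat_bound_add mat_bound_mult mat_bound_smult_le1 B CS CZ Z CA Y e)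
          (simp_all only: norm_minus_cancel norm_one e e2 order_refl)
      ultimately show "\<exists>B. mat_bound n C' B \<and> product_of_toeplitz n (Suc (Suc k))
        (1\<^sub>m n + e \<cdot>\<^sub>m A' e + (e ^ (2 * K + 1)) \<cdot>\<^sub>m (Z' + e \<cdot>\<^sub>m B))" by blast
    qed
  qed simp
qed

section \<open>Every direction is reached\<close>

definition direction :: "nat \<Rightarrow> nat \<Rightarrow> complex mat \<Rightarrow> bool" where
  "direction n k Z \<longleftrightarrow> (\<exists>C. Z \<in> directions n k C)"

lemma directions_nonneg: "Z \<in> directions n k C \<Longrightarrow> 0 \<le> C"
  by (cases k) (auto simp: mat_bound_def)

lemma direction_add: "direction n k Y \<Longrightarrow> direction n k Z \<Longrightarrow> direction n k (Y + Z)"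
  unfolding direction_def using directions_add by blast

lemma direction_smult: "direction n k Z \<Longrightarrow> direction n k (c \<cdot>\<^sub>m Z)"
  unfolding direction_def using directions_smult by blast

lemma direction_toeplitz: "toeplitz n Y \<Longrightarrow> direction n k Y"
  unfolding direction_def using mat_bound_exists[OF toeplitz_carrier] directions_toeplitz by blast

lemma direction_mono:
  assumes "k \<le> l" "direction n k Z"
  shows "direction n l Z"
  using assms
proof (induction l rule: dec_induct)
  case (step l)
  then show ?case unfolding direction_def using directions_Suc_superset directions_nonneg by blast
qed

lemma direction_shift_mult:
  assumes "toeplitz n Y" "1 \<le> k" "k \<le> m"
  shows "direction n m (shift_sum n k * Y)"
proof -
  obtain j where j: "k = Suc j" using assms(2) by (cases k) auto
  obtain C where C: "mat_bound n C Y" using mat_bound_exists[OF toeplitz_carrier[OF assms(1)]] by blast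
  have "0\<^sub>m n n \<in> directions n j C"
    using C by (intro directions_toeplitz toeplitz_zero) (auto simp: mat_bound_def)
  moreover have "shift_sum n k * Y = 0\<^sub>m n n + shift_sum n k * Y"
    using mult_carrier_mat[OF shift_sum_carrier toeplitz_carrier[OF assms(1)], of k] by simp
  ultimately have "direction n k (shift_sum n k * Y)"
    unfolding direction_def j using assms(1) C by auto
  then show ?thesis by (rule direction_mono[OF assms(3)])
qed

definition diagonal :: "nat \<Rightarrow> int \<Rightarrow> complex mat" where
  "diagonal n a = toep n (\<lambda>d. if d = a then 1 else 0)"

definition cut_diagonal :: "nat \<Rightarrow> int \<Rightarrow> nat \<Rightarrow> complex mat" where
  "cut_diagonal n d p = mat n n (\<lambda>(i, j). if int j - int i = d \<and> j < p then 1 else 0)"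

text \<open>
  The product consists of two diagonals. At most one of them is cut off, and the place of the cut is
  determined by \<open>a\<close>.
\<close>

lemma shift_mult_diagonal:
  assumes "i < n" "j < n"
  shows "(shift_sum n k * diagonal n a) $$ (i, j) =
    (if 0 \<le> int j - a \<and> int j - a < int n \<and>
        (int j - int i = a + int k \<or> int j - int i = a - int k) then 1 else 0)"
proof -
  have "(shift_sum n k * diagonal n a) $$ (i, j) =
    (\<Sum>l<n. if int l = int j - a then (if int l - int i = int k \<or> int l - int i = - int k then 1 else 0) else 0)"
    using assms unfolding shift_sum_def diagonal_def toep_def
    by (auto simp: scalar_prod_def atLeast0LessThan intro!: sum.cong)
  also have "\<dots> = (\<Sum>l<n. if l = nat (int j - a) then
      (if 0 \<le> int j - a \<and> (int l - int i = int k \<or> int l - int i = - int k) then 1 else 0) else 0)"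
    by (intro sum.cong) auto
  also have "\<dots> = (if nat (int j - a) < n then
      (if 0 \<le> int j - a \<and> (int (nat (int j - a)) - int i = int k \<or>
          int (nat (int j - a)) - int i = - int k) then 1 else 0) else 0)"
    by (subst sum.delta) auto
  also have "\<dots> = (if 0 \<le> int j - a \<and> int j - a < int n \<and>
        (int j - int i = a + int k \<or> int j - int i = a - int k) then 1 else 0)"
    using assms by (cases "0 \<le> int j - a") auto
  finally show ?thesis .
qed

text \<open>
  Up to sign and full diagonals, \<open>S\<^sub>k\<close> times a diagonal is a single cut diagonal, with \<open>p - d = k\<close> or \<open>p - d = n - k\<close>. As \<open>k\<close>
  runs through \<open>{1..n div 2}\<close>, every possible cut occurs.
\<close>

lemma direction_cut_diagonal:
  assumes "p \<le> n"
  shows "direction n (n div 2) (cut_diagonal n d p)"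
proof -
  let ?m = "n div 2"
  have diag: "direction n ?m (diagonal n a)" for a
    by (auto simp: diagonal_def intro: direction_toeplitz)
  have prod: "direction n ?m (shift_sum n k * diagonal n a)" if "1 \<le> k" "k \<le> ?m" for k a
    using that by (intro direction_shift_mult) (auto simp: diagonal_def)
  have pc: "shift_sum n k * diagonal n a \<in> carrier_mat n n" for k a
    by (rule mult_carrier_mat[OF shift_sum_carrier]) (simp add: diagonal_def)
  note idx = shift_mult_diagonal carrier_matD[OF pc]
  \<comment> \<open>If \<open>p - d\<close> is not in \<open>{1..n - 1}\<close>, the cut diagonal is zero or a full diagonal. The two remaining
    cases cover \<open>{1..n - 1}\<close> because \<open>n \<le> 2 * (n div 2) + 1\<close>.\<close>
  consider "int p - d \<le> 0" | "int n \<le> int p - d" | "1 \<le> int p - d" "int p - d \<le> int ?m"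
    | "int n - int ?m \<le> int p - d" "int p - d \<le> int n - 1" by linarith
  then show ?thesis
  proof cases
    case 1
    then have "cut_diagonal n d p = 0\<^sub>m n n"
      by (intro eq_matI) (auto simp: cut_diagonal_def)
    then show ?thesis by (simp add: direction_toeplitz toeplitz_zero)
  next
    case 2
    then have "cut_diagonal n d p = diagonal n d"
      by (intro eq_matI) (auto simp: cut_diagonal_def diagonal_def toep_def)
    then show ?thesis by (simp add: diag)
  next
    case 3
    define k where "k = nat (int p - d)"
    have k: "1 \<le> k" "k \<le> ?m" "d = int p - int k" using 3 by (auto simp: k_def)
    have "cut_diagonal n d p = diagonal n d +
        ((-1) \<cdot>\<^sub>m (shift_sum n k * diagonal n (int p)) + diagonal n (int p + int k))"
      using k(1) assms unfolding k(3)
      by (intro eq_matI) (auto simp: cut_diagonal_def diagonal_def toep_def idx[unfolded diagonal_def toep_def]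
          simp del: index_mult_mat)
    then show ?thesis by (simp only:) (intro direction_add direction_smult diag prod k)
  next
    case 4
    define k where "k = nat (int n - int p + d)"
    have k: "1 \<le> k" "k \<le> ?m" "d = int k + int p - int n" using 4 by (auto simp: k_def)
    have "cut_diagonal n d p = shift_sum n k * diagonal n (int p - int n) +
        (-1) \<cdot>\<^sub>m diagonal n (int p - int n - int k)"
      using k(1) assms unfolding k(3)
      by (intro eq_matI) (auto simp: cut_diagonal_def diagonal_def toep_def idx[unfolded diagonal_def toep_def]
          simp del: index_mult_mat)
    then show ?thesis by (simp only:) (intro direction_add direction_smult diag prod k)
  qed
qed

text \<open>
  A matrix unit is the difference of two consecutive cuts of one diagonal.
\<close>

lemma direction_all:
  assumes Z: "Z \<in> carrier_mat n n"
  shows "direction n (n div 2) Z"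
proof -
  define restrict where "restrict = (\<lambda>Q. mat n n (\<lambda>ij. if ij \<in> Q then Z $$ ij else 0))"
  have "direction n (n div 2) (restrict Q)" if "finite Q" "Q \<subseteq> {..<n} \<times> {..<n}" for Q
    using that
  proof (induction Q rule: finite_induct)
    case empty
    have "restrict {} = 0\<^sub>m n n" by (intro eq_matI) (auto simp: restrict_def)
    then show ?case by (simp add: direction_toeplitz toeplitz_zero)
  next
    case (insert ij Q)
    obtain i j where ij: "ij = (i, j)" "i < n" "j < n" using insert.prems by auto
    have "restrict (insert ij Q) = restrict Q + Z $$ (i, j) \<cdot>\<^sub>m
        (cut_diagonal n (int j - int i) (Suc j) + (-1) \<cdot>\<^sub>m cut_diagonal n (int j - int i) j)"
      using insert.hyps ij by (intro eq_matI) (auto simp: restrict_def cut_diagonal_def less_Suc_eq)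
    then show ?case using insert ij
      by (simp only:) (intro direction_add direction_smult direction_cut_diagonal, auto)
  qed
  from this[of "{..<n} \<times> {..<n}"] have "direction n (n div 2) (restrict ({..<n} \<times> {..<n}))" by simp
  also have "restrict ({..<n} \<times> {..<n}) = Z" using Z by (intro eq_matI) (auto simp: restrict_def)
  finally show ?thesis .
qed

section \<open>Density of the products\<close>

lemma sum_powers_extend:
  fixes a :: "nat \<Rightarrow> complex"
  assumes "\<And>s. D < s \<Longrightarrow> a s = 0" "D \<le> E"
  shows "(\<Sum>s\<le>E. a s * e ^ s) = (\<Sum>s\<le>D. a s * e ^ s)"
  using assms by (intro sum.mono_neutral_right) auto

text \<open>
  The powers of \<open>e\<close> separate the scales of the degeneration, so that the coefficients can be treated one at a time.
\<close>

lemma poly_funs_expand: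
  assumes "p \<in> poly_funs n" and A: "poly_entries n A"
  shows "\<exists>D Q. (\<forall>s. Q s \<in> poly_funs n) \<and> (\<forall>s>D. \<forall>Z. Q s Z = 0) \<and>
    (\<forall>e. \<forall>Z\<in>carrier_mat n n. p (A e + (e ^ K) \<cdot>\<^sub>m Z) = (\<Sum>s\<le>D. Q s Z * e ^ s))"
  using assms(1)
proof (induction p rule: poly_funs.induct)
  case (const c)
  show ?case
    by (rule exI[of _ 0], rule exI[of _ "\<lambda>s Z. if s = 0 then c else 0"]) (auto intro: poly_funs.const)
next
  case (entry i j)
  obtain q where q: "\<And>e. A e $$ (i, j) = poly q e"
    using A entry unfolding poly_entries_def by blast
  have Ac: "A e \<in> carrier_mat n n" for e using A by (simp add: poly_entries_def)
  define D where "D = max (degree q) K"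
  define Q where "Q = (\<lambda>s Z. coeff q s + (if s = K then Z $$ (i, j) else (0::complex)))"
  have "Q s \<in> poly_funs n" for s
    by (cases "s = K") (auto simp: Q_def intro!: poly_funs.add poly_funs.const poly_funs.entry entry)
  moreover have "Q s Z = 0" if "D < s" for s Z
    using that by (auto simp: Q_def D_def coeff_eq_0)
  moreover have "(A e + (e ^ K) \<cdot>\<^sub>m Z) $$ (i, j) = (\<Sum>s\<le>D. Q s Z * e ^ s)"
    if "Z \<in> carrier_mat n n" for e Z
  proof -
    have "(\<Sum>s\<le>D. Q s Z * e ^ s) =
      (\<Sum>s\<le>D. coeff q s * e ^ s) + (\<Sum>s\<le>D. if s = K then Z $$ (i, j) * e ^ s else 0)"
      by (simp only: sum.distrib[symmetric]) (intro sum.cong, auto simp: Q_def ring_distribs)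
    also have "(\<Sum>s\<le>D. coeff q s * e ^ s) = poly q e"
      unfolding poly_altdef by (rule sum_powers_extend) (auto simp: D_def coeff_eq_0)
    also have "(\<Sum>s\<le>D. if s = K then Z $$ (i, j) * e ^ s else 0) = Z $$ (i, j) * e ^ K"
      by (subst sum.delta) (auto simp: D_def)
    finally show ?thesis using that Ac[of e] entry by (simp add: q)
  qed
  ultimately show ?case by blast
next
  case (add p q)
  obtain D Q where Q: "\<And>s. Q s \<in> poly_funs n" "\<And>s Z. s > D \<Longrightarrow> Q s Z = 0"
    "\<And>e Z. Z \<in> carrier_mat n n \<Longrightarrow> p (A e + (e ^ K) \<cdot>\<^sub>m Z) = (\<Sum>s\<le>D. Q s Z * e ^ s)"
    using add.IH(1) by blast
  obtain E R where R: "\<And>s. R s \<in> poly_funs n" "\<And>s Z. s > E \<Longrightarrow> R s Z = 0"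
    "\<And>e Z. Z \<in> carrier_mat n n \<Longrightarrow> q (A e + (e ^ K) \<cdot>\<^sub>m Z) = (\<Sum>s\<le>E. R s Z * e ^ s)"
    using add.IH(2) by blast
  show ?case
  proof (intro exI[of _ "max D E"] exI[of _ "\<lambda>s Z. Q s Z + R s Z"] conjI allI ballI impI)
    fix e :: complex and Z :: "complex mat" assume Z: "Z \<in> carrier_mat n n"
    show "p (A e + e ^ K \<cdot>\<^sub>m Z) + q (A e + e ^ K \<cdot>\<^sub>m Z) = (\<Sum>s\<le>max D E. (Q s Z + R s Z) * e ^ s)"
      using sum_powers_extend[of D "\<lambda>s. Q s Z" "max D E" e] sum_powers_extend[of E "\<lambda>s. R s Z" "max D E" e]
      by (simp add: Q R Z ring_distribs sum.distrib)
  qed (auto simp: Q R intro!: poly_funs.add)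
next
  case (mult p q)
  obtain D Q where Q: "\<And>s. Q s \<in> poly_funs n" "\<And>s Z. s > D \<Longrightarrow> Q s Z = 0"
    "\<And>e Z. Z \<in> carrier_mat n n \<Longrightarrow> p (A e + (e ^ K) \<cdot>\<^sub>m Z) = (\<Sum>s\<le>D. Q s Z * e ^ s)"
    using mult.IH(1) by blast
  obtain E R where R: "\<And>s. R s \<in> poly_funs n" "\<And>s Z. s > E \<Longrightarrow> R s Z = 0"
    "\<And>e Z. Z \<in> carrier_mat n n \<Longrightarrow> q (A e + (e ^ K) \<cdot>\<^sub>m Z) = (\<Sum>s\<le>E. R s Z * e ^ s)"
    using mult.IH(2) by blast
  show ?case
  proof (intro exI[of _ "D + E"] exI[of _ "\<lambda>s Z. \<Sum>k\<le>s. Q k Z * R (s - k) Z"] conjI allI ballI impI)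
    fix e :: complex and Z :: "complex mat" assume Z: "Z \<in> carrier_mat n n"
    show "p (A e + e ^ K \<cdot>\<^sub>m Z) * q (A e + e ^ K \<cdot>\<^sub>m Z) =
        (\<Sum>s\<le>D + E. (\<Sum>k\<le>s. Q k Z * R (s - k) Z) * e ^ s)"
      unfolding Q(3)[OF Z] R(3)[OF Z] by (rule polynomial_product) (auto simp: Q R)
  next
    fix s and Z :: "complex mat" assume s: "D + E < s"
    show "(\<Sum>k\<le>s. Q k Z * R (s - k) Z) = 0"
    proof (rule sum.neutral, rule ballI)
      fix k assume "k \<in> {..s}"
      then have "D < k \<or> E < s - k" using s by auto
      then show "Q k Z * R (s - k) Z = 0" using Q(2) R(2) by auto
    qed
  qed (auto intro!: poly_funs_sum poly_funs.mult Q R)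
qed

text \<open>
  The products approach a moving base point from every direction, and this forces the coefficients of the
  expansion around the base point to vanish one after another.
\<close>

lemma toeplitz_products_dense:
  assumes p: "p \<in> poly_funs n"
    and van: "\<And>A. product_of_toeplitz n (n div 2 + 1) A \<Longrightarrow> p A = 0"
    and M: "M \<in> carrier_mat n n"
  shows "p M = 0"
proof -
  obtain A K where K: "K \<ge> 1" and A: "poly_entries n A" and
    ex: "\<And>C. \<exists>C'. \<forall>e Z. norm e \<le> 1 \<longrightarrow> Z \<in> directions n (n div 2) C \<longrightarrow>
    (\<exists>B. mat_bound n C' B \<and>
      product_of_toeplitz n (Suc (n div 2)) (1\<^sub>m n + e \<cdot>\<^sub>m A e + (e ^ K) \<cdot>\<^sub>m (Z + e \<cdot>\<^sub>m B)))"
    using degenerating_products[of n "n div 2"] by blast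
  define A' where "A' = (\<lambda>e. 1\<^sub>m n + e \<cdot>\<^sub>m A e)"
  have "poly_entries n (\<lambda>e. 1\<^sub>m n + poly [:0, 1:] e \<cdot>\<^sub>m A e)"
    by (intro poly_entries_add poly_entries_smult poly_entries_const A) simp
  then have A': "poly_entries n A'" by (simp add: A'_def)
  obtain D Q where Q: "\<And>s. Q s \<in> poly_funs n" "\<And>s Z. s > D \<Longrightarrow> Q s Z = 0"
    "\<And>e Z. Z \<in> carrier_mat n n \<Longrightarrow> p (A' e + (e ^ K) \<cdot>\<^sub>m Z) = (\<Sum>s\<le>D. Q s Z * e ^ s)"
    using poly_funs_expand[OF p A', of K] by blast
  \<comment> \<open>The first coefficient that does not vanish identically survives the limit \<open>e \<rightarrow> 0\<close> along the family of
    products that approaches a given direction \<open>Z\<close>. Induction on \<open>s\<close> therefore kills all of them.\<close>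
  have zero: "Q s Z = 0" if "Z \<in> carrier_mat n n" for s Z
    using that
  proof (induction s arbitrary: Z rule: less_induct)
    case (less s)
    show ?case
    proof (cases "s \<le> D")
      case True
      obtain C where "Z \<in> directions n (n div 2) C"
        using direction_all[OF less.prems] by (auto simp: direction_def)
      with ex[of C] obtain C' where "\<forall>e. \<exists>B. norm e \<le> 1 \<longrightarrow> mat_bound n C' B \<and>
          product_of_toeplitz n (Suc (n div 2)) (A' e + (e ^ K) \<cdot>\<^sub>m (Z + e \<cdot>\<^sub>m B))"
        unfolding A'_def by blast
      from choice[OF this] obtain B where
        B: "\<And>e. norm e \<le> 1 \<Longrightarrow> mat_bound n C' (B e)" and
        prod: "\<And>e. norm e \<le> 1 \<Longrightarrow>
          product_of_toeplitz n (Suc (n div 2)) (A' e + (e ^ K) \<cdot>\<^sub>m (Z + e \<cdot>\<^sub>m B e))" by blast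
      define V where "V = (\<lambda>e. Z + e \<cdot>\<^sub>m B e)"
      have Vc: "V e \<in> carrier_mat n n" if "norm e \<le> 1" for e
        using mat_bound_carrier[OF B[OF that]] less.prems by (auto simp: V_def)
      have ev: "\<forall>\<^sub>F e in at (0::complex). norm e \<le> 1 \<and> e \<noteq> 0"
        unfolding eventually_at by (intro exI[of _ 1]) (auto simp: dist_norm)
      have lim: "((\<lambda>e. V e $$ (i, j)) \<longlongrightarrow> Z $$ (i, j)) (at 0)" if ij: "i < n" "j < n" for i j
      proof -
        have "\<forall>\<^sub>F e in at 0. norm (V e $$ (i, j) - Z $$ (i, j)) \<le> norm e * C'"
          using ev
        proof eventually_elim
          case (elim e)
          then have "mat_bound n C' (B e)" using B by auto
          then show ?case using ij less.prems
            by (auto simp: V_def mat_bound_def norm_mult intro!: mult_left_mono)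
        qed
        then have "((\<lambda>e. V e $$ (i, j) - Z $$ (i, j)) \<longlongrightarrow> 0) (at 0)"
          by (rule tendsto_0_le[OF tendsto_ident_at])
        then show ?thesis by (simp add: LIM_zero_iff)
      qed
      have sum0: "(\<Sum>t\<in>{s..D}. Q t (V e) * e ^ (t - s)) = 0" if e: "norm e \<le> 1" "e \<noteq> 0" for e
      proof -
        have "0 = p (A' e + (e ^ K) \<cdot>\<^sub>m V e)"
          using van prod[OF e(1)] by (simp add: V_def)
        also have "\<dots> = (\<Sum>t\<le>D. Q t (V e) * e ^ t)" by (rule Q(3)[OF Vc[OF e(1)]])
        also have "\<dots> = (\<Sum>t\<in>{s..D}. Q t (V e) * e ^ t)"
          using less.IH[OF _ Vc[OF e(1)]] by (intro sum.mono_neutral_right) auto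
        also have "\<dots> = (\<Sum>t\<in>{s..D}. e ^ s * (Q t (V e) * e ^ (t - s)))"
          by (intro sum.cong) (auto simp: power_add[symmetric] mult.left_commute)
        also have "\<dots> = e ^ s * (\<Sum>t\<in>{s..D}. Q t (V e) * e ^ (t - s))"
          by (simp add: sum_distrib_left)
        finally show ?thesis using e(2) by simp
      qed
      have "((\<lambda>e. \<Sum>t\<in>{s..D}. Q t (V e) * e ^ (t - s)) \<longlongrightarrow> (\<Sum>t\<in>{s..D}. Q t Z * 0 ^ (t - s))) (at 0)"
        by (intro tendsto_sum tendsto_mult poly_funs_tendsto[OF Q(1)] lim tendsto_power tendsto_ident_at)
      moreover have "(\<Sum>t\<in>{s..D}. Q t Z * 0 ^ (t - s)) = Q s Z"
      proof -
        have "(\<Sum>t\<in>{s..D}. Q t Z * 0 ^ (t - s)) = (\<Sum>t\<in>{s}. Q t Z * 0 ^ (t - s))"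
          using True by (intro sum.mono_neutral_right) auto
        then show ?thesis by simp
      qed
      moreover have "((\<lambda>e. \<Sum>t\<in>{s..D}. Q t (V e) * e ^ (t - s)) \<longlongrightarrow> 0) (at 0)"
        by (rule tendsto_eventually) (use ev in eventually_elim, use sum0 in auto)
      ultimately show ?thesis using tendsto_unique[of "at (0::complex)"] by fastforce
    qed (simp add: Q)
  qed
  \<comment> \<open>At \<open>e = 1\<close> the expanded argument runs through all matrices.\<close>
  have "A' 1 \<in> carrier_mat n n" using A' by (simp add: poly_entries_def)
  then have "M = A' 1 + 1 ^ K \<cdot>\<^sub>m (M + (-1) \<cdot>\<^sub>m A' 1)" and c: "M + (-1) \<cdot>\<^sub>m A' 1 \<in> carrier_mat n n"
    using M by (auto intro!: eq_matI)
  then have "p M = (\<Sum>s\<le>D. Q s (M + (-1) \<cdot>\<^sub>m A' 1) * 1 ^ s)" using Q(3)[OF c, of 1] by simp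
  then show ?thesis using zero[OF c] by simp
qed

section \<open>The number of Toeplitz factors of a generic matrix\<close>

theorem corollary3p5:
  fixes n :: nat
  assumes "n \<ge> 1"
  shows "every_generic n (product_of_toeplitz n (n div 2 + 1)) \<and>
    (\<forall>s. every_generic n (product_of_toeplitz n s) \<longrightarrow> n div 2 + 1 \<le> s)"
proof (intro conjI allI impI)
  let ?r = "n div 2 + 1"
  let ?F = "param_product n [0..<?r]"
  have "every_generic n (\<lambda>A. A \<in> range ?F)"
  proof (rule dense_param_image_generic)
    show "finite (params n [0..<?r])" by (simp add: params_def)
    show "(\<lambda>t. ?F t $$ (i, j)) \<in> coord_funs (params n [0..<?r])" if "i < n" "j < n" for i j
      by (rule param_product_coord_funs[OF that order_refl])
    show "?F t \<in> carrier_mat n n" for t by simp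
    show "p A = 0" if "p \<in> poly_funs n" "\<And>t. p (?F t) = 0" "A \<in> carrier_mat n n" for p A
      using toeplitz_products_dense[OF that(1) _ that(3)] that(2)
      by (auto simp: product_of_toeplitz_iff_param)
  qed
  moreover have "(\<lambda>A. A \<in> range ?F) = product_of_toeplitz n ?r"
    by (auto simp: product_of_toeplitz_iff_param fun_eq_iff)
  ultimately show "every_generic n (product_of_toeplitz n ?r)" by simp
next
  fix s assume "every_generic n (product_of_toeplitz n s)"
  then obtain q M where q: "q \<in> poly_funs n" "M \<in> carrier_mat n n" "q M \<noteq> 0"
    "\<forall>A\<in>carrier_mat n n. q A \<noteq> 0 \<longrightarrow> product_of_toeplitz n s A" unfolding every_generic_iff by blast
  show "n div 2 + 1 \<le> s"
  proof (rule ccontr)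
    assume "\<not> ?thesis"
    then have "s \<le> n div 2" by simp
    then obtain P N where P: "P \<in> poly_funs n" "\<And>A. product_of_toeplitz n s A \<Longrightarrow> P A = 0"
      "N \<in> carrier_mat n n" "P N \<noteq> 0" using few_toeplitz_hypersurface[OF assms] by blast
    obtain A where "A \<in> carrier_mat n n" "P A * q A \<noteq> 0"
      using poly_funs_domain[OF P(1) q(1) P(3) q(2) P(4) q(3)] by blast
    then show False using P(2) q(4) by auto
  qed
qed

end
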